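(* Let $G$ be a bigraph without isolated vertices and with at least one edge, and for each $k\in\mathbb{N}$, let $d_k=|\{w\in V_2(G) : d_G(w)=k\}|$ be the number of vertices in $V_2(G)$ that have degree $k$. If for each $k\geq 2$ we have either $d_k=0$ or $d_k\geq\binom{v_1(G)}{k}$, then $G$ is a strong Sidorenko bigraph.
   Context: A bigraph is a triple $G=(V_1,V_2,E)$ with $V_1,V_2$ disjoint finite sets and $E\subseteq V_1\times V_2$; write $V_i(G)=V_i$, $v_i(G)=|V_i|$, $E(G)=E$, $e(G)=|E|$; $d_G(w)$ is the degree of the vertex $w$. Given probability spaces $\Omega=(X,\mu)$ and $\Lambda=(Y,\nu)$, a bigraphon over $\Omega$ and $\Lambda$ is a bounded measurable function $W:X\times Y\to\mathbb{R}_+=[0,\infty)$. A bigraph $G$ is a strong Sidorenko bigraph if for every bigraphon $W$ (over any probability spaces $\Omega=(X,\mu)$, $\Lambda=(Y,\nu)$) and all sequences $(f_v)_{v\in V_1(G)}$, $(g_w)_{w\in V_2(G)}$ of bounded measurable functions $f_v:X\to\mathbb{R}_+$, $g_w:Y\to\mathbb{R}_+$, we have $$\int_{X^{V_1(G)}\times Y^{V_2(G)}}\prod_{v\in V_1(G)}f_v(x_v)\prod_{w\in V_2(G)}g_w(y_w)\prod_{(v,w)\in E(G)}W(x_v,y_w)\,d(\mu\otimes\nu)(x,y)$$ $$\geq\left(\int_{X\times Y}\prod_{v\in V_1(G)}f_v(x)^{1/e(G)}\prod_{w\in V_2(G)}g_w(y)^{1/e(G)}\,W(x,y)\,d(\mu\otimes\nu)(x,y)\right)^{e(G)}.$$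 *)

theory Defs
  imports "HOL-Probability.Probability"
begin

record 'v bigraph =
  verts1 :: "'v set"
  verts2 :: "'v set"
  edges :: "('v \<times> 'v) set"

definition is_bigraph :: "'v bigraph \<Rightarrow> bool" where
  "is_bigraph G \<longleftrightarrow>
     finite (verts1 G) \<and> finite (verts2 G) \<and> verts1 G \<inter> verts2 G = {} \<and>
     edges G \<subseteq> verts1 G \<times> verts2 G"

definition degree :: "'v bigraph \<Rightarrow> 'v \<Rightarrow> nat" where
  "degree G u = card {e \<in> edges G. fst e = u \<or> snd e = u}"

definition isolated :: "'v bigraph \<Rightarrow> 'v \<Rightarrow> bool" where
  "isolated G u \<longleftrightarrow> u \<in> verts1 G \<union> verts2 G \<and> degree G u = 0"

definition num_degree2 :: "'v bigraph \<Rightarrow> nat \<Rightarrow> nat" where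
  "num_degree2 G k = card {w \<in> verts2 G. degree G w = k}"

definition nonneg_bounded_measurable :: "'a measure \<Rightarrow> ('a \<Rightarrow> real) \<Rightarrow> bool" where
  "nonneg_bounded_measurable M f \<longleftrightarrow>
     f \<in> borel_measurable M \<and> (\<forall>x\<in>space M. 0 \<le> f x) \<and> bounded (f ` space M)"

definition bigraphon :: "'x measure \<Rightarrow> 'y measure \<Rightarrow> ('x \<times> 'y \<Rightarrow> real) \<Rightarrow> bool" where
  "bigraphon \<mu> \<nu> W \<longleftrightarrow>
     prob_space \<mu> \<and> prob_space \<nu> \<and> nonneg_bounded_measurable (\<mu> \<Otimes>\<^sub>M \<nu>) W"

text \<open>
  HOL cannot quantify over types inside a formula, so the types carrying the two probability
  spaces are parameters. ``Every probability space'' is expressed by leaving the type variables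
  \<open>'x\<close> and \<open>'y\<close> free in a theorem that concludes
  \<open>strong_sidorenko TYPE('x) TYPE('y) G\<close>.

  The exponent \<open>1 / e(G)\<close> makes sense only when \<open>G\<close> has an edge. In that case
  \<open>0 powr (1 / e(G)) = 0\<close>, so \<open>powr\<close> is the usual power on all of \<open>[0, \<infinity>)\<close>.
\<close>

definition strong_sidorenko :: "'x itself \<Rightarrow> 'y itself \<Rightarrow> 'v bigraph \<Rightarrow> bool" where
  "strong_sidorenko (_ :: 'x itself) (_ :: 'y itself) G \<longleftrightarrow>
     (\<forall>(\<mu> :: 'x measure) (\<nu> :: 'y measure) W f g.
        bigraphon \<mu> \<nu> W \<longrightarrow>
        (\<forall>v\<in>verts1 G. nonneg_bounded_measurable \<mu> (f v)) \<longrightarrow>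
        (\<forall>w\<in>verts2 G. nonneg_bounded_measurable \<nu> (g w)) \<longrightarrow>
        (\<integral>(x, y). (\<Prod>v\<in>verts1 G. f v (x v)) * (\<Prod>w\<in>verts2 G. g w (y w)) *
                  (\<Prod>(v, w)\<in>edges G. W (x v, y w))
           \<partial>((\<Pi>\<^sub>M v\<in>verts1 G. \<mu>) \<Otimes>\<^sub>M (\<Pi>\<^sub>M w\<in>verts2 G. \<nu>)))
        \<ge> (\<integral>(x, y). (\<Prod>v\<in>verts1 G. f v x powr (1 / card (edges G))) *
                    (\<Prod>w\<in>verts2 G. g w y powr (1 / card (edges G))) * W (x, y)
             \<partial>(\<mu> \<Otimes>\<^sub>M \<nu>)) ^ card (edges G))"

end

theory Submission
  imports Defs
begin

text \<open>
  Averaging over the permutations of \<open>V\<^sub>1\<close> (arithmetic versus geometric mean) and merging the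
  vertices of \<open>V\<^sub>2\<close> of equal degree \<open>k\<close> (Hoelder) bounds the left-hand side below by
  \<open>\<integral> \<Prod>\<^sub>v F(x\<^sub>v) \<Prod>\<^sub>k A\<^sub>k(x) powr a\<^sub>k\<close>. Here \<open>A\<^sub>k(x)\<close> is the product over all \<open>k\<close>-subsets \<open>S\<close> of
  \<open>V\<^sub>1\<close> of \<open>\<integral> \<Prod>\<^sub>v\<^sub>\<in>\<^sub>S W\<^sub>k(x\<^sub>v, y) dy\<close>, and \<open>a\<^sub>k = d\<^sub>k / (v\<^sub>1 choose k)\<close>, which is at least \<open>1\<close> for \<open>k \<ge> 2\<close>.

  Let \<open>B\<^sub>k\<close> arise from \<open>A\<^sub>k\<close> by replacing each factor \<open>W\<^sub>k(x\<^sub>v, y)\<close> by its mean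
  \<open>D\<^sub>k(x\<^sub>v)\<close> over \<open>y\<close>. The key point is that \<open>A\<^sub>k\<close> may be replaced by \<open>B\<^sub>k\<close>. When all
  exponents are \<open>1\<close>, consider for a set \<open>C\<close> of incidences \<open>(v, S)\<close> with \<open>|S| = k\<close> the integral in which
  only the incidences in \<open>C\<close> carry \<open>W\<^sub>k\<close> and all others carry \<open>D\<^sub>k\<close>. The empty set and a single incidence give
  the same value. By Cauchy-Schwarz for the reflection exchanging two vertices \<open>s\<close> and \<open>t\<close>, the value at \<open>C\<close> is
  at most the mean of the values at the two foldings of \<open>C\<close>. So both foldings of a maximiser are maximisers, and
  a suitable sequence of foldings turns any nonempty set into the set of all incidences.

  Exponents \<open>a\<^sub>k \<ge> 1\<close> are reached by weighting with \<open>B\<^sub>k powr (a\<^sub>k - 1)\<close> and a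
  tangent-line bound; only the one-variable integral \<open>(\<integral> F \<Prod>\<^sub>k D\<^sub>k powr (k d\<^sub>k / v\<^sub>1))^v\<^sub>1\<close> is left, to which
  Hoelder applies because \<open>e(G) \<ge> v\<^sub>1\<close>.
\<close>

subsection \<open>Bounded nonnegative measurable functions\<close>

abbreviation (input) nbm :: "'a measure \<Rightarrow> ('a \<Rightarrow> real) \<Rightarrow> bool" where
  "nbm \<equiv> nonneg_bounded_measurable"

lemma nbmI:
  assumes "f \<in> borel_measurable M" "\<And>x. x \<in> space M \<Longrightarrow> 0 \<le> f x" "\<And>x. x \<in> space M \<Longrightarrow> f x \<le> B"
  shows "nbm M f"
  using assms unfolding nonneg_bounded_measurable_def bounded_iff
  by (auto intro!: exI[of _ B])

lemma nbm_measurable: "nbm M f \<Longrightarrow> f \<in> borel_measurable M"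
  by (simp add: nonneg_bounded_measurable_def)

lemma nbm_nonneg: "nbm M f \<Longrightarrow> x \<in> space M \<Longrightarrow> 0 \<le> f x"
  by (simp add: nonneg_bounded_measurable_def)

lemma nbmE:
  assumes "nbm M f"
  obtains B where "B \<ge> 0" "\<And>x. x \<in> space M \<Longrightarrow> f x \<le> B"
proof -
  obtain B where B: "\<And>x. x \<in> space M \<Longrightarrow> norm (f x) \<le> B"
    using assms unfolding nonneg_bounded_measurable_def bounded_iff by blast
  show ?thesis
  proof (rule that[of "max B 0"])
    fix x assume "x \<in> space M"
    then show "f x \<le> max B 0" using B[of x] by simp
  qed simp
qed

lemma nbm_const: "0 \<le> c \<Longrightarrow> nbm M (\<lambda>_. c)"
  by (rule nbmI[where B = c]) auto

lemma nbm_mult: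
  assumes "nbm M f" "nbm M g"
  shows "nbm M (\<lambda>x. f x * g x)"
proof -
  obtain B where B: "B \<ge> 0" "\<And>x. x \<in> space M \<Longrightarrow> f x \<le> B" using nbmE[OF assms(1)] by blast
  obtain C where C: "C \<ge> 0" "\<And>x. x \<in> space M \<Longrightarrow> g x \<le> C" using nbmE[OF assms(2)] by blast
  show ?thesis
    by (rule nbmI[where B = "B * C"])
       (use assms B C in \<open>auto intro!: borel_measurable_times mult_mono mult_nonneg_nonneg
          dest: nbm_measurable nbm_nonneg\<close>)
qed

lemma nbm_add:
  assumes "nbm M f" "nbm M g"
  shows "nbm M (\<lambda>x. f x + g x)"
proof -
  obtain B where B: "B \<ge> 0" "\<And>x. x \<in> space M \<Longrightarrow> f x \<le> B" using nbmE[OF assms(1)] by blast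
  obtain C where C: "C \<ge> 0" "\<And>x. x \<in> space M \<Longrightarrow> g x \<le> C" using nbmE[OF assms(2)] by blast
  show ?thesis
    by (rule nbmI[where B = "B + C"])
       (use assms B C in \<open>auto intro!: borel_measurable_add add_mono add_nonneg_nonneg
          dest: nbm_measurable nbm_nonneg\<close>)
qed

lemma nbm_prod:
  assumes "\<And>i. i \<in> I \<Longrightarrow> nbm M (f i)"
  shows "nbm M (\<lambda>x. \<Prod>i\<in>I. f i x)"
  using assms by (induction I rule: infinite_finite_induct) (auto intro!: nbm_const nbm_mult)

lemma nbm_sum:
  assumes "\<And>i. i \<in> I \<Longrightarrow> nbm M (f i)"
  shows "nbm M (\<lambda>x. \<Sum>i\<in>I. f i x)"
  using assms by (induction I rule: infinite_finite_induct) (auto intro!: nbm_const nbm_add)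

lemma nbm_powr:
  assumes "nbm M f" "0 \<le> r"
  shows "nbm M (\<lambda>x. f x powr r)"
proof -
  obtain B where B: "B \<ge> 0" "\<And>x. x \<in> space M \<Longrightarrow> f x \<le> B" using nbmE[OF assms(1)] by blast
  show ?thesis
    by (rule nbmI[where B = "B powr r"])
       (use assms B in \<open>auto intro!: powr_real_measurable powr_mono2
          dest: nbm_measurable nbm_nonneg\<close>)
qed

lemma nbm_comp:
  assumes "nbm N f" "h \<in> measurable M N"
  shows "nbm M (\<lambda>x. f (h x))"
proof -
  obtain B where B: "B \<ge> 0" "\<And>x. x \<in> space N \<Longrightarrow> f x \<le> B" using nbmE[OF assms(1)] by blast
  show ?thesis
    by (rule nbmI[where B = B])
      (use assms B measurable_space[OF assms(2)] in
        \<open>auto intro!: measurable_compose[OF assms(2)] dest: nbm_measurable nbm_nonneg\<close>)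
qed

lemma nbm_integrable: "finite_measure M \<Longrightarrow> nbm M f \<Longrightarrow> integrable M f"
  by (metis (no_types, lifting) AE_I2 abs_of_nonneg finite_measure.integrable_const_bound
      nbmE nbm_measurable nbm_nonneg real_norm_def)

lemma nbm_integral_nonneg: "nbm M f \<Longrightarrow> 0 \<le> integral\<^sup>L M f"
  by (meson Bochner_Integration.integral_nonneg nbm_nonneg)

lemma nbm_integral_mono:
  "finite_measure M \<Longrightarrow> nbm M f \<Longrightarrow> nbm M g \<Longrightarrow> (\<And>x. x \<in> space M \<Longrightarrow> f x \<le> g x)
    \<Longrightarrow> integral\<^sup>L M f \<le> integral\<^sup>L M g"
  by (intro integral_mono nbm_integrable)

lemma nbm_integral:
  assumes "prob_space N" "nbm (M \<Otimes>\<^sub>M N) (\<lambda>p. f (fst p) (snd p))"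
  shows "nbm M (\<lambda>x. \<integral>y. f x y \<partial>N)"
proof -
  interpret N: prob_space N by fact
  obtain B where B: "B \<ge> 0" "\<And>x. x \<in> space (M \<Otimes>\<^sub>M N) \<Longrightarrow> f (fst x) (snd x) \<le> B"
    using nbmE[OF assms(2)] by blast
  have sec: "nbm N (f x)" if "x \<in> space M" for x
    using nbm_comp[OF assms(2), of "\<lambda>y. (x, y)" N] that by simp
  show ?thesis
  proof (rule nbmI[where B = B])
    show "(\<lambda>x. \<integral>y. f x y \<partial>N) \<in> borel_measurable M"
      using nbm_measurable[OF assms(2)]
      by (intro N.borel_measurable_lebesgue_integral) (simp add: case_prod_beta')
    fix x assume x: "x \<in> space M"
    show "0 \<le> (\<integral>y. f x y \<partial>N)" using sec[OF x] by (rule nbm_integral_nonneg)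
    have "(\<integral>y. f x y \<partial>N) \<le> (\<integral>y. B \<partial>N)"
      using sec[OF x] x B
      by (intro nbm_integral_mono nbm_const N.finite_measure_axioms) (auto simp: space_pair_measure)
    then show "(\<integral>y. f x y \<partial>N) \<le> B" by (simp add: N.prob_space)
  qed
qed

lemma nbm_section:
  "nbm (M \<Otimes>\<^sub>M N) W \<Longrightarrow> x \<in> space M \<Longrightarrow> nbm N (\<lambda>y. W (x, y))"
  by (erule nbm_comp) simp

lemma finite_measure_if_prob: "prob_space M \<Longrightarrow> finite_measure M"
  by (simp add: prob_space.finite_measure)

lemma nbm_Fubini:
  assumes "prob_space M" "prob_space N" "nbm (M \<Otimes>\<^sub>M N) (\<lambda>p. f (fst p) (snd p))"
  shows "(\<integral>p. f (fst p) (snd p) \<partial>(M \<Otimes>\<^sub>M N)) = (\<integral>x. \<integral>y. f x y \<partial>N \<partial>M)"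
    and "(\<integral>x. \<integral>y. f x y \<partial>N \<partial>M) = (\<integral>y. \<integral>x. f x y \<partial>M \<partial>N)"
proof -
  interpret M: prob_space M by fact
  interpret N: prob_space N by fact
  interpret pair_prob_space M N ..
  have i: "integrable (M \<Otimes>\<^sub>M N) (\<lambda>p. f (fst p) (snd p))"
    using assms by (intro nbm_integrable P.finite_measure_axioms)
  show "(\<integral>p. f (fst p) (snd p) \<partial>(M \<Otimes>\<^sub>M N)) = (\<integral>x. \<integral>y. f x y \<partial>N \<partial>M)"
    using integral_fst'[OF i] by simp
  show "(\<integral>x. \<integral>y. f x y \<partial>N \<partial>M) = (\<integral>y. \<integral>x. f x y \<partial>M \<partial>N)"
    using Fubini_integral[of f] i by (simp add: case_prod_beta')
qed

section \<open>Weighted arithmetic-geometric means and Hoelder's inequality\<close>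

text \<open>Jensen's inequality for \<open>exp\<close> at the points \<open>ln (x i)\<close>. If
  some \<open>x i\<close> is \<open>0\<close>, the product vanishes whatever the weight, because
  \<open>0 powr 0 = 0\<close>.\<close>

lemma weighted_arith_geom_mean:
  fixes x :: "'i \<Rightarrow> real"
  assumes "finite S" "\<And>i. i \<in> S \<Longrightarrow> 0 \<le> x i" "\<And>i. i \<in> S \<Longrightarrow> 0 \<le> t i" "sum t S = 1"
  shows "(\<Prod>i\<in>S. x i powr t i) \<le> (\<Sum>i\<in>S. t i * x i)"
proof (cases "\<exists>i\<in>S. x i = 0")
  case True
  then have "(\<Prod>i\<in>S. x i powr t i) = 0" using assms(1) by auto
  moreover have "0 \<le> (\<Sum>i\<in>S. t i * x i)" by (intro sum_nonneg mult_nonneg_nonneg assms)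
  ultimately show ?thesis by linarith
next
  case False
  then have pos: "\<And>i. i \<in> S \<Longrightarrow> 0 < x i" using assms(2) by force
  have "S \<noteq> {}" using assms(4) by auto
  have "(\<Prod>i\<in>S. x i powr t i) = exp (\<Sum>i\<in>S. t i * ln (x i))"
    using assms(1) pos by (subst exp_sum) (auto simp: powr_def intro!: prod.cong dest!: pos)
  also have "\<dots> \<le> (\<Sum>i\<in>S. t i * exp (ln (x i)))"
    using convex_on_sum[OF assms(1) \<open>S \<noteq> {}\<close> exp_convex assms(4), of "\<lambda>i. ln (x i)"] assms(3) by simp
  also have "\<dots> = (\<Sum>i\<in>S. t i * x i)" using pos by simp
  finally show ?thesis .
qed

text \<open>After dividing each \<open>f i\<close> by its mean, the weighted arithmetic-geometric
  mean inequality applies pointwise, and the integral of the arithmetic mean is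
  \<open>sum t I = 1\<close>. If some mean is \<open>0\<close>, that \<open>f i\<close> vanishes
  almost everywhere and so does the product.\<close>

lemma Hoelder_finite_family:
  assumes M: "prob_space M" and "finite I"
    and f: "\<And>i. i \<in> I \<Longrightarrow> nbm M (f i)"
    and t: "\<And>i. i \<in> I \<Longrightarrow> 0 < t i" "sum t I = 1"
  shows "(\<integral>x. (\<Prod>i\<in>I. f i x powr t i) \<partial>M) \<le> (\<Prod>i\<in>I. (\<integral>x. f i x \<partial>M) powr t i)"
proof (cases "\<exists>i\<in>I. (\<integral>x. f i x \<partial>M) = 0")
  case True
  interpret prob_space M by fact
  obtain i where i: "i \<in> I" "(\<integral>x. f i x \<partial>M) = 0" using True by auto
  have "AE x in M. f i x = 0"
    using i f by (subst integral_nonneg_eq_0_iff_AE[symmetric])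
      (auto intro!: nbm_integrable finite_measure_axioms dest: nbm_nonneg)
  then have "(\<integral>x. (\<Prod>i\<in>I. f i x powr t i) \<partial>M) = (\<integral>x. 0 \<partial>M)"
    using i \<open>finite I\<close> f
    by (intro integral_cong_AE borel_measurable_prod)
       (auto intro!: powr_real_measurable dest: nbm_measurable elim!: eventually_mono)
  then show ?thesis by (simp add: prod_nonneg)
next
  case False
  interpret prob_space M by fact
  define c where "c i = (\<integral>x. f i x \<partial>M)" for i
  have c: "c i > 0" if "i \<in> I" for i
    using False that nbm_integral_nonneg[OF f[OF that]] unfolding c_def by (metis less_eq_real_def)
  have n: "nbm M (\<lambda>x. f i x / c i)" if "i \<in> I" for i
    using nbm_mult[OF f[OF that] nbm_const[of "1 / c i"]] c[OF that] by simp
  have "(\<integral>x. (\<Prod>i\<in>I. f i x powr t i) \<partial>M) / (\<Prod>i\<in>I. c i powr t i)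
      = (\<integral>x. (\<Prod>i\<in>I. (f i x / c i) powr t i) \<partial>M)"
    by (simp add: powr_divide prod_dividef)
  also have "\<dots> \<le> (\<integral>x. (\<Sum>i\<in>I. t i * (f i x / c i)) \<partial>M)"
    using n t
    by (intro nbm_integral_mono nbm_prod nbm_sum nbm_powr nbm_mult nbm_const
         weighted_arith_geom_mean \<open>finite I\<close> finite_measure_axioms)
       (auto intro: less_imp_le nbm_nonneg[OF n])
  also have "\<dots> = (\<Sum>i\<in>I. t i * (c i / c i))"
  proof -
    have "integrable M (\<lambda>x. t i * (f i x / c i))" if "i \<in> I" for i
      by (rule integrable_mult_right) (rule nbm_integrable[OF finite_measure_axioms n[OF that]])
    then have "(\<integral>x. (\<Sum>i\<in>I. t i * (f i x / c i)) \<partial>M) = (\<Sum>i\<in>I. \<integral>x. t i * (f i x / c i) \<partial>M)"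
      by (rule Bochner_Integration.integral_sum)
    then show ?thesis
      by (simp only: Bochner_Integration.integral_mult_right_zero
          Bochner_Integration.integral_divide_zero c_def)
  qed
  also have "\<dots> = 1"
  proof -
    have "(\<Sum>i\<in>I. t i * (c i / c i)) = sum t I"
      by (intro sum.cong refl) (use c in force)
    then show ?thesis using t(2) by simp
  qed
  finally have "(\<integral>x. (\<Prod>i\<in>I. f i x powr t i) \<partial>M) / (\<Prod>i\<in>I. c i powr t i) \<le> 1" .
  moreover have "0 < (\<Prod>i\<in>I. c i powr t i)"
    by (rule prod_pos) (use c in force)
  ultimately show ?thesis by (simp add: divide_le_eq c_def)
qed

subsection \<open>The reflection inequality\<close>

text \<open>Each index \<open>i\<close> gets its own copy \<open>h i\<close> of the variable
  \<open>y\<close>, which turns the product of integrals into one integral over a product space. For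
  fixed \<open>h\<close> the integrand is a function of \<open>a\<close> times a function of
  \<open>b\<close>, so these two integrals separate once \<open>h\<close> is moved
  outermost.\<close>

lemma integral_prod_kernel:
  fixes p q :: "'i \<Rightarrow> 'x \<times> 'y \<Rightarrow> real"
  assumes mu: "prob_space \<mu>" and nu: "prob_space \<nu>" and I: "finite I"
    and \<alpha>: "nbm \<mu> \<alpha>" and \<beta>: "nbm \<mu> \<beta>"
    and \<rho>: "\<And>i. i \<in> I \<Longrightarrow> nbm \<nu> (\<rho> i)"
    and p: "\<And>i. i \<in> I \<Longrightarrow> nbm (\<mu> \<Otimes>\<^sub>M \<nu>) (p i)"
    and q: "\<And>i. i \<in> I \<Longrightarrow> nbm (\<mu> \<Otimes>\<^sub>M \<nu>) (q i)"
  shows "(\<integral>a. \<integral>b. \<alpha> a * \<beta> b * (\<Prod>i\<in>I. \<integral>y. \<rho> i y * p i (a, y) * q i (b, y) \<partial>\<nu>) \<partial>\<mu> \<partial>\<mu>)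
    = (\<integral>h. (\<Prod>i\<in>I. \<rho> i (h i)) * (\<integral>a. \<alpha> a * (\<Prod>i\<in>I. p i (a, h i)) \<partial>\<mu>)
          * (\<integral>b. \<beta> b * (\<Prod>i\<in>I. q i (b, h i)) \<partial>\<mu>) \<partial>(\<Pi>\<^sub>M i\<in>I. \<nu>))" (is "?L = ?R")
proof -
  interpret mu: prob_space \<mu> by fact
  interpret nu: prob_space \<nu> by fact
  interpret P: product_prob_space "\<lambda>_. \<nu>" I ..
  let ?P = "\<Pi>\<^sub>M i\<in>I. \<nu>"
  have P: "prob_space ?P" by (rule prob_space_PiM) (rule nu)
  define k where "k a b h = \<alpha> a * \<beta> b * (\<Prod>i\<in>I. \<rho> i (h i) * p i (a, h i) * q i (b, h i))" for a b h
  have pm: "nbm (M \<Otimes>\<^sub>M ?P) (\<lambda>z. f i (fst z, snd z i))"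
    if "nbm (M \<Otimes>\<^sub>M \<nu>) (f i)" "i \<in> I" for f :: "'i \<Rightarrow> 'x \<times> 'y \<Rightarrow> real" and i M
    using that by (intro nbm_comp[OF that(1)]) measurable
  have \<rho>m: "nbm ?P (\<lambda>h. \<rho> i (h i))" if "i \<in> I" for i
    using that by (intro nbm_comp[OF \<rho>]) measurable
  have ps: "nbm ?P (\<lambda>h. p i (a, h i))" "nbm ?P (\<lambda>h. q i (a, h i))"
    if "i \<in> I" "a \<in> space \<mu>" for i a
    using nbm_section[OF pm[of \<mu> p i]] nbm_section[OF pm[of \<mu> q i]] p q that by auto
  have eq1: "\<alpha> a * \<beta> b * (\<Prod>i\<in>I. \<integral>y. \<rho> i y * p i (a, y) * q i (b, y) \<partial>\<nu>) = (\<integral>h. k a b h \<partial>?P)"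
    if ab: "a \<in> space \<mu>" "b \<in> space \<mu>" for a b
  proof -
    have "(\<Prod>i\<in>I. \<integral>y. \<rho> i y * p i (a, y) * q i (b, y) \<partial>\<nu>)
       = (\<integral>h. (\<Prod>i\<in>I. \<rho> i (h i) * p i (a, h i) * q i (b, h i)) \<partial>?P)"
      using ab by (intro P.product_integral_prod[symmetric] I nbm_integrable nu.finite_measure_axioms
          nbm_mult \<rho> nbm_section[OF p] nbm_section[OF q])
    then show ?thesis by (simp add: k_def)
  qed
  have kb: "nbm (\<mu> \<Otimes>\<^sub>M ?P) (\<lambda>z. k a (fst z) (snd z))" if a: "a \<in> space \<mu>" for a
    unfolding k_def
    by (intro nbm_mult nbm_prod nbm_comp[OF \<rho>m, of _ snd] nbm_comp[OF ps(1), of _ _ snd] pm q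
        nbm_comp[OF \<beta>] nbm_const nbm_nonneg[OF \<alpha>] a measurable_fst measurable_snd)
  have ka: "nbm (\<mu> \<Otimes>\<^sub>M ?P) (\<lambda>z. \<integral>b. k (fst z) b (snd z) \<partial>\<mu>)"
  proof (rule nbm_integral[OF mu])
    have "nbm ((\<mu> \<Otimes>\<^sub>M ?P) \<Otimes>\<^sub>M \<mu>) (\<lambda>z. f i (fst (fst z), snd (fst z) i))"
      if "nbm (\<mu> \<Otimes>\<^sub>M \<nu>) (f i)" "i \<in> I" for f :: "'i \<Rightarrow> 'x \<times> 'y \<Rightarrow> real" and i
      using that by (intro nbm_comp[OF that(1)]) measurable
    moreover have "nbm ((\<mu> \<Otimes>\<^sub>M ?P) \<Otimes>\<^sub>M \<mu>) (\<lambda>z. f i (snd z, snd (fst z) i))"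
      if "nbm (\<mu> \<Otimes>\<^sub>M \<nu>) (f i)" "i \<in> I" for f :: "'i \<Rightarrow> 'x \<times> 'y \<Rightarrow> real" and i
      using that by (intro nbm_comp[OF that(1)]) measurable
    moreover have "nbm ((\<mu> \<Otimes>\<^sub>M ?P) \<Otimes>\<^sub>M \<mu>) (\<lambda>z. \<rho> i (snd (fst z) i))" if "i \<in> I" for i
      using that by (intro nbm_comp[OF \<rho>]) measurable
    moreover have "nbm ((\<mu> \<Otimes>\<^sub>M ?P) \<Otimes>\<^sub>M \<mu>) (\<lambda>z. \<alpha> (fst (fst z)))"
      by (intro nbm_comp[OF \<alpha>]) measurable
    moreover have "nbm ((\<mu> \<Otimes>\<^sub>M ?P) \<Otimes>\<^sub>M \<mu>) (\<lambda>z. \<beta> (snd z))"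
      by (intro nbm_comp[OF \<beta>]) measurable
    ultimately show "nbm ((\<mu> \<Otimes>\<^sub>M ?P) \<Otimes>\<^sub>M \<mu>) (\<lambda>z. k (fst (fst z)) (snd z) (snd (fst z)))"
      unfolding k_def using p q by (intro nbm_mult nbm_prod) simp_all
  qed
  have "?L = (\<integral>a. \<integral>b. \<integral>h. k a b h \<partial>?P \<partial>\<mu> \<partial>\<mu>)"
    by (intro Bochner_Integration.integral_cong refl eq1)
  also have "\<dots> = (\<integral>a. \<integral>h. \<integral>b. k a b h \<partial>\<mu> \<partial>?P \<partial>\<mu>)"
    by (intro Bochner_Integration.integral_cong refl nbm_Fubini(2) mu P kb)
  also have "\<dots> = (\<integral>h. \<integral>a. \<integral>b. k a b h \<partial>\<mu> \<partial>\<mu> \<partial>?P)"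
    by (intro nbm_Fubini(2) mu P ka)
  also have "\<dots> = ?R"
  proof (intro Bochner_Integration.integral_cong refl)
    fix h assume "h \<in> space ?P"
    have "(\<integral>a. \<integral>b. k a b h \<partial>\<mu> \<partial>\<mu>) = (\<integral>a. (\<integral>b. ((\<Prod>i\<in>I. \<rho> i (h i)) * (\<alpha> a * (\<Prod>i\<in>I. p i (a, h i))))
         * (\<beta> b * (\<Prod>i\<in>I. q i (b, h i))) \<partial>\<mu>) \<partial>\<mu>)"
      by (simp add: k_def prod.distrib mult_ac)
    also have "\<dots> = (\<Prod>i\<in>I. \<rho> i (h i)) * (\<integral>a. \<alpha> a * (\<Prod>i\<in>I. p i (a, h i)) \<partial>\<mu>)
          * (\<integral>b. \<beta> b * (\<Prod>i\<in>I. q i (b, h i)) \<partial>\<mu>)"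
      unfolding Bochner_Integration.integral_mult_right_zero
        Bochner_Integration.integral_mult_left_zero by simp
    finally show "(\<integral>a. \<integral>b. k a b h \<partial>\<mu> \<partial>\<mu>) = \<dots>" .
  qed
  finally show ?thesis .
qed

text \<open>By \<open>integral_prod_kernel\<close> the three integrals are those of
  \<open>R * A * B\<close>, \<open>R * A * A\<close> and \<open>R * B * B\<close> with nonnegative
  \<open>R\<close>, so the pointwise bound \<open>2 * A * B \<le> A * A + B * B\<close> suffices.
  This additive form of Cauchy-Schwarz is the one that an argument with maximisers can use.\<close>

lemma reflection_inequality:
  fixes p q :: "'i \<Rightarrow> 'x \<times> 'y \<Rightarrow> real"
  assumes mu: "prob_space \<mu>" and nu: "prob_space \<nu>" and I: "finite I"
    and \<alpha>: "nbm \<mu> \<alpha>" and \<beta>: "nbm \<mu> \<beta>"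
    and \<rho>: "\<And>i. i \<in> I \<Longrightarrow> nbm \<nu> (\<rho> i)"
    and p: "\<And>i. i \<in> I \<Longrightarrow> nbm (\<mu> \<Otimes>\<^sub>M \<nu>) (p i)"
    and q: "\<And>i. i \<in> I \<Longrightarrow> nbm (\<mu> \<Otimes>\<^sub>M \<nu>) (q i)"
  shows "2 * (\<integral>a. \<integral>b. \<alpha> a * \<beta> b * (\<Prod>i\<in>I. \<integral>y. \<rho> i y * p i (a, y) * q i (b, y) \<partial>\<nu>) \<partial>\<mu> \<partial>\<mu>)
    \<le> (\<integral>a. \<integral>b. \<alpha> a * \<alpha> b * (\<Prod>i\<in>I. \<integral>y. \<rho> i y * p i (a, y) * p i (b, y) \<partial>\<nu>) \<partial>\<mu> \<partial>\<mu>)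
     + (\<integral>a. \<integral>b. \<beta> a * \<beta> b * (\<Prod>i\<in>I. \<integral>y. \<rho> i y * q i (a, y) * q i (b, y) \<partial>\<nu>) \<partial>\<mu> \<partial>\<mu>)"
proof -
  interpret nu: prob_space \<nu> by fact
  let ?P = "\<Pi>\<^sub>M i\<in>I. \<nu>"
  interpret P: prob_space ?P by (rule prob_space_PiM) (rule nu)
  define R where "R h = (\<Prod>i\<in>I. \<rho> i (h i))" for h
  define A where "A h = (\<integral>a. \<alpha> a * (\<Prod>i\<in>I. p i (a, h i)) \<partial>\<mu>)" for h
  define B where "B h = (\<integral>a. \<beta> a * (\<Prod>i\<in>I. q i (a, h i)) \<partial>\<mu>)" for h
  have pm: "nbm (?P \<Otimes>\<^sub>M \<mu>) (\<lambda>z. f i (snd z, fst z i))"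
    if "nbm (\<mu> \<Otimes>\<^sub>M \<nu>) (f i)" "i \<in> I" for f :: "'i \<Rightarrow> 'x \<times> 'y \<Rightarrow> real" and i
    using that by (intro nbm_comp[OF that(1)]) measurable
  have "nbm ?P (\<lambda>h. \<rho> i (h i))" if "i \<in> I" for i
    using that by (intro nbm_comp[OF \<rho>]) measurable
  then have R: "nbm ?P R" unfolding R_def by (intro nbm_prod)
  have A: "nbm ?P A" unfolding A_def
    by (intro nbm_integral[OF mu] nbm_mult nbm_prod pm p nbm_comp[OF \<alpha>] measurable_snd)
  have B: "nbm ?P B" unfolding B_def
    by (intro nbm_integral[OF mu] nbm_mult nbm_prod pm q nbm_comp[OF \<beta>] measurable_snd)
  have int: "integrable ?P (\<lambda>h. R h * C h * D h)" if "nbm ?P C" "nbm ?P D" for C D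
    using that by (intro nbm_integrable P.finite_measure_axioms nbm_mult R)
  have "2 * (\<integral>h. R h * A h * B h \<partial>?P) = (\<integral>h. 2 * (R h * A h * B h) \<partial>?P)"
    by simp
  also have "\<dots> \<le> (\<integral>h. R h * A h * A h + R h * B h * B h \<partial>?P)"
  proof (rule integral_mono)
    fix h assume h: "h \<in> space ?P"
    have "R h * (2 * (A h * B h)) \<le> R h * (A h * A h + B h * B h)"
      using sum_squares_bound[of "A h" "B h"] nbm_nonneg[OF R h]
      by (intro mult_left_mono) (auto simp: power2_eq_square)
    then show "2 * (R h * A h * B h) \<le> R h * A h * A h + R h * B h * B h"
      by (simp add: algebra_simps)
  qed (use int A B in \<open>auto intro!: Bochner_Integration.integrable_add\<close>)
  also have "\<dots> = (\<integral>h. R h * A h * A h \<partial>?P) + (\<integral>h. R h * B h * B h \<partial>?P)"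
    by (intro Bochner_Integration.integral_add int A B)
  finally show ?thesis
    unfolding A_def B_def R_def
    using integral_prod_kernel[OF mu nu I \<alpha> \<beta> \<rho> p q] integral_prod_kernel[OF mu nu I \<alpha> \<alpha> \<rho> p p]
      integral_prod_kernel[OF mu nu I \<beta> \<beta> \<rho> q q]
    by simp
qed

subsection \<open>Folding along a transposition\<close>

text \<open>Weights are indexed by incidences \<open>(v, S)\<close> so that a kernel can be replaced
  by its mean at a single incidence and a folding acts by precomposition on
  \<open>w\<close>.\<close>

definition incidence_integral ::
  "'x measure \<Rightarrow> 'y measure \<Rightarrow> 'v set \<Rightarrow> ('x \<Rightarrow> real) \<Rightarrow> 'v set set
    \<Rightarrow> ('v \<times> 'v set \<Rightarrow> 'x \<times> 'y \<Rightarrow> real) \<Rightarrow> real" where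
  "incidence_integral \<mu> \<nu> V F \<S> w =
    (\<integral>x. (\<Prod>v\<in>V. F (x v)) * (\<Prod>S\<in>\<S>. \<integral>y. (\<Prod>v\<in>S. w (v, S) (x v, y)) \<partial>\<nu>) \<partial>(\<Pi>\<^sub>M v\<in>V. \<mu>))"

text \<open>Incidences on the \<open>t\<close> side of the reflection go to their mirror image, so \<open>w \<circ> fold_edge s t\<close> is the
  folding of \<open>w\<close> that keeps the \<open>s\<close> side.\<close>

definition fold_edge :: "'v \<Rightarrow> 'v \<Rightarrow> 'v \<times> 'v set \<Rightarrow> 'v \<times> 'v set" where
  "fold_edge s t = (\<lambda>(v, S).
     if v = t \<or> (t \<in> S \<and> s \<notin> S)
     then (Transposition.transpose s t v, Transposition.transpose s t ` S) else (v, S))"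

lemma prob_space_PiM_const: "prob_space \<mu> \<Longrightarrow> prob_space (\<Pi>\<^sub>M v\<in>V. \<mu>)"
  by (rule prob_space_PiM)

lemma nbm_component: "nbm \<mu> f \<Longrightarrow> v \<in> V \<Longrightarrow> nbm (\<Pi>\<^sub>M v\<in>V. \<mu>) (\<lambda>x. f (x v))"
  by (rule nbm_comp) (auto intro: measurable_component_singleton)

lemma nbm_incidence_factor:
  assumes nu: "prob_space \<nu>" and S: "S \<subseteq> V"
    and w: "\<And>v. v \<in> S \<Longrightarrow> nbm (\<mu> \<Otimes>\<^sub>M \<nu>) (w v)" and g: "nbm \<nu> g"
  shows "nbm (\<Pi>\<^sub>M v\<in>V. \<mu>) (\<lambda>x. \<integral>y. g y * (\<Prod>v\<in>S. w v (x v, y)) \<partial>\<nu>)"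
proof (intro nbm_integral[OF nu] nbm_mult nbm_prod nbm_comp[OF g] measurable_snd)
  fix v assume "v \<in> S"
  with S have "v \<in> V" by auto
  then show "nbm ((\<Pi>\<^sub>M v\<in>V. \<mu>) \<Otimes>\<^sub>M \<nu>) (\<lambda>p. w v (fst p v, snd p))"
    by (intro nbm_comp[OF w[OF \<open>v \<in> S\<close>]]) measurable
qed

lemma nbm_incidence_integrand:
  assumes nu: "prob_space \<nu>" and \<S>: "\<And>S. S \<in> \<S> \<Longrightarrow> S \<subseteq> V" and F: "nbm \<mu> F"
    and w: "\<And>v S. S \<in> \<S> \<Longrightarrow> v \<in> S \<Longrightarrow> nbm (\<mu> \<Otimes>\<^sub>M \<nu>) (w (v, S))"
  shows "nbm (\<Pi>\<^sub>M v\<in>V. \<mu>)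
    (\<lambda>x. (\<Prod>v\<in>V. F (x v)) * (\<Prod>S\<in>\<S>. \<integral>y. (\<Prod>v\<in>S. w (v, S) (x v, y)) \<partial>\<nu>))"
proof (intro nbm_mult nbm_prod nbm_component F)
  fix S assume "S \<in> \<S>"
  then show "nbm (\<Pi>\<^sub>M v\<in>V. \<mu>) (\<lambda>x. \<integral>y. (\<Prod>v\<in>S. w (v, S) (x v, y)) \<partial>\<nu>)"
    using nbm_incidence_factor[OF nu \<S>, where w = "\<lambda>v. w (v, S)" and g = "\<lambda>_. 1"] w by (simp add: nbm_const)
qed

lemma integral_PiM_insert2:
  assumes mu: "prob_space \<mu>" and V: "finite V" "s \<notin> V" "t \<notin> V" "s \<noteq> t"
    and f: "nbm (\<Pi>\<^sub>M v\<in>insert t (insert s V). \<mu>) f"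
  shows "(\<integral>x. f x \<partial>(\<Pi>\<^sub>M v\<in>insert t (insert s V). \<mu>))
       = (\<integral>z. \<integral>a. \<integral>b. f (z(s := a, t := b)) \<partial>\<mu> \<partial>\<mu> \<partial>(\<Pi>\<^sub>M v\<in>V. \<mu>))"
    and "nbm (\<Pi>\<^sub>M v\<in>V. \<mu>) (\<lambda>z. \<integral>a. \<integral>b. f (z(s := a, t := b)) \<partial>\<mu> \<partial>\<mu>)"
proof -
  interpret mu: prob_space \<mu> by fact
  interpret P: product_prob_space "\<lambda>_. \<mu>" UNIV ..
  note fin = finite_measure_if_prob[OF prob_space_PiM_const[OF mu]]
  have m1: "nbm (\<Pi>\<^sub>M v\<in>insert s V. \<mu>) (\<lambda>x. \<integral>b. f (x(t := b)) \<partial>\<mu>)"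
  proof (rule nbm_integral[OF mu], rule nbm_comp[OF f])
    show "(\<lambda>p. (fst p)(t := snd p)) \<in> (\<Pi>\<^sub>M v\<in>insert s V. \<mu>) \<Otimes>\<^sub>M \<mu> \<rightarrow>\<^sub>M (\<Pi>\<^sub>M v\<in>insert t (insert s V). \<mu>)"
      by (rule measurable_fun_upd[where J = "insert s V"]) auto
  qed
  show "nbm (\<Pi>\<^sub>M v\<in>V. \<mu>) (\<lambda>z. \<integral>a. \<integral>b. f (z(s := a, t := b)) \<partial>\<mu> \<partial>\<mu>)"
  proof (rule nbm_integral[OF mu], rule nbm_comp[OF m1])
    show "(\<lambda>p. (fst p)(s := snd p)) \<in> (\<Pi>\<^sub>M v\<in>V. \<mu>) \<Otimes>\<^sub>M \<mu> \<rightarrow>\<^sub>M (\<Pi>\<^sub>M v\<in>insert s V. \<mu>)"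
      by (rule measurable_fun_upd[where J = V]) auto
  qed
  have "(\<integral>x. f x \<partial>(\<Pi>\<^sub>M v\<in>insert t (insert s V). \<mu>))
      = (\<integral>x. \<integral>b. f (x(t := b)) \<partial>\<mu> \<partial>(\<Pi>\<^sub>M v\<in>insert s V. \<mu>))"
    using V f by (intro P.product_integral_insert nbm_integrable fin) auto
  also have "\<dots> = (\<integral>z. \<integral>a. \<integral>b. f (z(s := a, t := b)) \<partial>\<mu> \<partial>\<mu> \<partial>(\<Pi>\<^sub>M v\<in>V. \<mu>))"
    using V m1 by (intro P.product_integral_insert nbm_integrable fin) auto
  finally show "(\<integral>x. f x \<partial>(\<Pi>\<^sub>M v\<in>insert t (insert s V). \<mu>)) = \<dots>" .
qed

lemma fold_edge_id: "v \<in> S \<Longrightarrow> v \<noteq> t \<Longrightarrow> s \<in> S \<or> t \<notin> S \<Longrightarrow> fold_edge s t (v, S) = (v, S)"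
  by (auto simp: fold_edge_def)

lemma fold_edge_id2: "v \<in> S \<Longrightarrow> t \<notin> S \<Longrightarrow> fold_edge s t (v, S) = (v, S)"
  by (auto simp: fold_edge_def)

lemma transpose_image_both:
  "s \<in> S \<Longrightarrow> t \<in> S \<Longrightarrow> Transposition.transpose s t ` S = S"
  by (auto simp: Transposition.transpose_def image_iff)

lemma transpose_image_swap:
  "s \<notin> S \<Longrightarrow> t \<in> S \<Longrightarrow> Transposition.transpose s t ` S = insert s (S - {t})"
  by (auto simp: Transposition.transpose_def image_iff)

lemma fold_edge_both: "s \<in> S \<Longrightarrow> t \<in> S \<Longrightarrow> fold_edge s t (t, S) = (s, S)"
  by (simp add: fold_edge_def transpose_image_both)

lemma fold_edge_swap:
  "s \<notin> S \<Longrightarrow> t \<in> S \<Longrightarrow> fold_edge s t (v, S) = (Transposition.transpose s t v, insert s (S - {t}))"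
  by (simp add: fold_edge_def transpose_image_swap)

section \<open>Integrating out the two coordinates exchanged by a reflection\<close>

context
  fixes \<mu> :: "'x measure" and \<nu> :: "'y measure" and V :: "'v set" and F :: "'x \<Rightarrow> real"
    and \<S> :: "'v set set"
  assumes mu: "prob_space \<mu>" and nu: "prob_space \<nu>" and V: "finite V" and F: "nbm \<mu> F"
    and \<S>: "finite \<S>" "\<And>S. S \<in> \<S> \<Longrightarrow> S \<subseteq> V"
begin

text \<open>Everything that depends on the coordinate of \<open>s\<close> but not on that of
  \<open>t\<close>, where \<open>a\<close> is the value at \<open>s\<close> and the remaining
  coordinates are read from \<open>z\<close>. With \<open>s\<close> and \<open>t\<close> exchanged
  it describes the other side of the reflection.\<close>

private definition \<alpha> :: "('v \<times> 'v set \<Rightarrow> 'x \<times> 'y \<Rightarrow> real) \<Rightarrow> 'v \<Rightarrow> 'v \<Rightarrow> ('v \<Rightarrow> 'x) \<Rightarrow> 'x \<Rightarrow> real" where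
  "\<alpha> w s t z a = F a * (\<Prod>S\<in>{S\<in>\<S>. s \<in> S \<and> t \<notin> S}.
      \<integral>y. w (s, S) (a, y) * (\<Prod>v\<in>S - {s}. w (v, S) (z v, y)) \<partial>\<nu>)"

private definition \<rho> :: "('v \<times> 'v set \<Rightarrow> 'x \<times> 'y \<Rightarrow> real) \<Rightarrow> 'v \<Rightarrow> 'v \<Rightarrow> ('v \<Rightarrow> 'x) \<Rightarrow> 'v set \<Rightarrow> 'y \<Rightarrow> real" where
  "\<rho> w s t z S y = (\<Prod>v\<in>S - {s, t}. w (v, S) (z v, y))"

text \<open>The part of the integrand that is constant in both integrated coordinates.\<close>

private definition \<phi> :: "('v \<times> 'v set \<Rightarrow> 'x \<times> 'y \<Rightarrow> real) \<Rightarrow> 'v \<Rightarrow> 'v \<Rightarrow> ('v \<Rightarrow> 'x) \<Rightarrow> real" where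
  "\<phi> w s t z = (\<Prod>v\<in>V - {s, t}. F (z v)) *
     (\<Prod>S\<in>{S\<in>\<S>. s \<notin> S \<and> t \<notin> S}. \<integral>y. (\<Prod>v\<in>S. w (v, S) (z v, y)) \<partial>\<nu>)"

text \<open>The shape is that of the left-hand side of \<open>reflection_inequality\<close>, indexed
  by the sets that contain both \<open>s\<close> and \<open>t\<close>.\<close>

private definition inner :: "('v \<times> 'v set \<Rightarrow> 'x \<times> 'y \<Rightarrow> real) \<Rightarrow> 'v \<Rightarrow> 'v \<Rightarrow> ('v \<Rightarrow> 'x) \<Rightarrow> real" where
  "inner w s t z = (\<integral>a. \<integral>b. \<alpha> w s t z a * \<alpha> w t s z b * (\<Prod>S\<in>{S\<in>\<S>. s \<in> S \<and> t \<in> S}.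
      \<integral>y. \<rho> w s t z S y * w (s, S) (a, y) * w (t, S) (b, y) \<partial>\<nu>) \<partial>\<mu> \<partial>\<mu>)"

text \<open>The sets in \<open>\<S>\<close> fall into four classes: those with neither
  \<open>s\<close> nor \<open>t\<close> go into \<open>\<phi>\<close>, those with exactly one into
  the two copies of \<open>\<alpha>\<close>, and those with both give the kernels that couple
  \<open>a\<close> and \<open>b\<close>.\<close>

private lemma integrand_split:
  assumes st: "s \<in> V" "t \<in> V" "s \<noteq> t"
  shows "(\<Prod>v\<in>V. F ((z(s := a, t := b)) v)) *
      (\<Prod>S\<in>\<S>. \<integral>y. (\<Prod>v\<in>S. w (v, S) ((z(s := a, t := b)) v, y)) \<partial>\<nu>)
    = \<phi> w s t z * (\<alpha> w s t z a * \<alpha> w t s z b * (\<Prod>S\<in>{S\<in>\<S>. s \<in> S \<and> t \<in> S}.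
      \<integral>y. \<rho> w s t z S y * w (s, S) (a, y) * w (t, S) (b, y) \<partial>\<nu>))"
proof -
  let ?x = "z(s := a, t := b)"
  let ?D = "\<lambda>S. \<integral>y. (\<Prod>v\<in>S. w (v, S) (?x v, y)) \<partial>\<nu>"
  have V': "V = insert s (insert t (V - {s, t}))" using st by auto
  have finS: "finite S" if "S \<in> \<S>" for S using finite_subset[OF \<S>(2)[OF that] V] .
  have 1: "(\<Prod>v\<in>V. F (?x v)) = F a * F b * (\<Prod>v\<in>V - {s, t}. F (z v))"
    using V st by (subst V') (simp add: mult_ac)
  have \<S>': "\<S> = ({S\<in>\<S>. s \<notin> S \<and> t \<notin> S} \<union> {S\<in>\<S>. s \<in> S \<and> t \<notin> S}) \<union>
      ({S\<in>\<S>. t \<in> S \<and> s \<notin> S} \<union> {S\<in>\<S>. s \<in> S \<and> t \<in> S})" by blast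
  have 2: "prod ?D \<S> = (prod ?D {S\<in>\<S>. s \<notin> S \<and> t \<notin> S} * prod ?D {S\<in>\<S>. s \<in> S \<and> t \<notin> S}) *
      (prod ?D {S\<in>\<S>. t \<in> S \<and> s \<notin> S} * prod ?D {S\<in>\<S>. s \<in> S \<and> t \<in> S})"
    (is "_ = (prod ?D ?A * prod ?D ?B) * (prod ?D ?C * prod ?D ?E)")
  proof -
    have fin: "finite ?A" "finite ?B" "finite ?C" "finite ?E" using \<S>(1) by auto
    have "prod ?D \<S> = prod ?D ((?A \<union> ?B) \<union> (?C \<union> ?E))" using \<S>' by (rule arg_cong)
    also have "\<dots> = prod ?D (?A \<union> ?B) * prod ?D (?C \<union> ?E)"
      using fin by (intro prod.union_disjoint) auto
    also have "prod ?D (?A \<union> ?B) = prod ?D ?A * prod ?D ?B"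
      using fin by (intro prod.union_disjoint) auto
    also have "prod ?D (?C \<union> ?E) = prod ?D ?C * prod ?D ?E"
      using fin by (intro prod.union_disjoint) auto
    finally show ?thesis .
  qed
  have D0: "?D S = (\<integral>y. (\<Prod>v\<in>S. w (v, S) (z v, y)) \<partial>\<nu>)" if "S \<in> {S\<in>\<S>. s \<notin> S \<and> t \<notin> S}" for S
    using that by (intro Bochner_Integration.integral_cong refl prod.cong) auto
  have Ds: "?D S = (\<integral>y. w (s, S) (a, y) * (\<Prod>v\<in>S - {s}. w (v, S) (z v, y)) \<partial>\<nu>)"
    if "S \<in> {S\<in>\<S>. s \<in> S \<and> t \<notin> S}" for S
  proof (intro Bochner_Integration.integral_cong refl)
    fix y
    have "(\<Prod>v\<in>S - {s}. w (v, S) (?x v, y)) = (\<Prod>v\<in>S - {s}. w (v, S) (z v, y))"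
    proof (intro prod.cong refl)
      fix v assume "v \<in> S - {s}"
      then have "v \<noteq> s" "v \<noteq> t" using that by auto
      then show "w (v, S) (?x v, y) = w (v, S) (z v, y)" by simp
    qed
    then show "(\<Prod>v\<in>S. w (v, S) (?x v, y)) = w (s, S) (a, y) * (\<Prod>v\<in>S - {s}. w (v, S) (z v, y))"
      using that st finS by (subst prod.remove[of S s]) auto
  qed
  have Dt: "?D S = (\<integral>y. w (t, S) (b, y) * (\<Prod>v\<in>S - {t}. w (v, S) (z v, y)) \<partial>\<nu>)"
    if "S \<in> {S\<in>\<S>. t \<in> S \<and> s \<notin> S}" for S
  proof (intro Bochner_Integration.integral_cong refl)
    fix y
    have "(\<Prod>v\<in>S - {t}. w (v, S) (?x v, y)) = (\<Prod>v\<in>S - {t}. w (v, S) (z v, y))"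
    proof (intro prod.cong refl)
      fix v assume "v \<in> S - {t}"
      then have "v \<noteq> s" "v \<noteq> t" using that by auto
      then show "w (v, S) (?x v, y) = w (v, S) (z v, y)" by simp
    qed
    then show "(\<Prod>v\<in>S. w (v, S) (?x v, y)) = w (t, S) (b, y) * (\<Prod>v\<in>S - {t}. w (v, S) (z v, y))"
      using that st finS by (subst prod.remove[of S t]) auto
  qed
  have Dst: "?D S = (\<integral>y. \<rho> w s t z S y * w (s, S) (a, y) * w (t, S) (b, y) \<partial>\<nu>)"
    if S: "S \<in> {S\<in>\<S>. s \<in> S \<and> t \<in> S}" for S
  proof (intro Bochner_Integration.integral_cong refl)
    fix y
    have S': "S = insert s (insert t (S - {s, t}))" using S by auto
    have "(\<Prod>v\<in>insert s (insert t (S - {s, t})). w (v, S) (?x v, y))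
        = w (s, S) (a, y) * (w (t, S) (b, y) * (\<Prod>v\<in>S - {s, t}. w (v, S) (?x v, y)))"
      using finS S st by simp
    also have "(\<Prod>v\<in>S - {s, t}. w (v, S) (?x v, y)) = \<rho> w s t z S y"
      unfolding \<rho>_def by (intro prod.cong) auto
    finally show "(\<Prod>v\<in>S. w (v, S) (?x v, y)) = \<rho> w s t z S y * w (s, S) (a, y) * w (t, S) (b, y)"
      unfolding S'[symmetric] by (simp only: mult_ac)
  qed
  show ?thesis
    unfolding 1 2 \<phi>_def \<alpha>_def
    by (simp only: prod.cong[OF refl D0] prod.cong[OF refl Ds] prod.cong[OF refl Dt]
        prod.cong[OF refl Dst] mult_ac)
qed

private lemma incidence_integral_split:
  assumes st: "s \<in> V" "t \<in> V" "s \<noteq> t"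
    and w: "\<And>v S. S \<in> \<S> \<Longrightarrow> v \<in> S \<Longrightarrow> nbm (\<mu> \<Otimes>\<^sub>M \<nu>) (w (v, S))"
  shows "incidence_integral \<mu> \<nu> V F \<S> w = (\<integral>z. \<phi> w s t z * inner w s t z \<partial>(\<Pi>\<^sub>M v\<in>V - {s, t}. \<mu>))"
    and "nbm (\<Pi>\<^sub>M v\<in>V - {s, t}. \<mu>) (\<lambda>z. \<phi> w s t z * inner w s t z)"
proof -
  let ?f = "\<lambda>x. (\<Prod>v\<in>V. F (x v)) * (\<Prod>S\<in>\<S>. \<integral>y. (\<Prod>v\<in>S. w (v, S) (x v, y)) \<partial>\<nu>)"
  have V': "insert t (insert s (V - {s, t})) = V" using st by auto
  have f: "nbm (\<Pi>\<^sub>M v\<in>insert t (insert s (V - {s, t})). \<mu>) ?f"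
    unfolding V' by (intro nbm_incidence_integrand nu \<S> F w)
  have eq: "(\<integral>a. \<integral>b. ?f (z(s := a, t := b)) \<partial>\<mu> \<partial>\<mu>) = \<phi> w s t z * inner w s t z" for z
    unfolding integrand_split[OF st] inner_def by (simp only: Bochner_Integration.integral_mult_right_zero)
  show "incidence_integral \<mu> \<nu> V F \<S> w = (\<integral>z. \<phi> w s t z * inner w s t z \<partial>(\<Pi>\<^sub>M v\<in>V - {s, t}. \<mu>))"
    using integral_PiM_insert2(1)[OF mu _ _ _ st(3) f] V unfolding eq V' incidence_integral_def by simp
  show "nbm (\<Pi>\<^sub>M v\<in>V - {s, t}. \<mu>) (\<lambda>z. \<phi> w s t z * inner w s t z)"
    using integral_PiM_insert2(2)[OF mu _ _ _ st(3) f] V unfolding eq by simp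
qed

text \<open>Incidences of sets on the \<open>s\<close> side are fixed by the fold. Replacing
  \<open>t\<close> by \<open>s\<close> is a bijection from the sets on the \<open>t\<close> side to
  those on the \<open>s\<close> side, because \<open>\<S>\<close> is closed under the transposition,
  and the fold copies the weights along it.\<close>

private lemma fold_\<alpha>:
  assumes st: "s \<in> V" "t \<in> V" "s \<noteq> t"
    and closed: "\<forall>S\<in>\<S>. Transposition.transpose s t ` S \<in> \<S>"
  shows "\<alpha> (w \<circ> fold_edge s t) s t z = \<alpha> w s t z" "\<alpha> (w \<circ> fold_edge s t) t s z = \<alpha> w s t z"
proof -
  show "\<alpha> (w \<circ> fold_edge s t) s t z = \<alpha> w s t z"
  proof
    fix a
    have "(\<Prod>v\<in>S - {s}. w (fold_edge s t (v, S)) (z v, y)) = (\<Prod>v\<in>S - {s}. w (v, S) (z v, y))"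
      if "s \<in> S" "t \<notin> S" for S y
      using that by (intro prod.cong refl) (auto simp: fold_edge_id2)
    then show "\<alpha> (w \<circ> fold_edge s t) s t z a = \<alpha> w s t z a"
      using st by (auto simp: \<alpha>_def fold_edge_id2 intro!: prod.cong)
  qed
  show "\<alpha> (w \<circ> fold_edge s t) t s z = \<alpha> w s t z"
  proof
    fix a
    let ?A = "{S\<in>\<S>. t \<in> S \<and> s \<notin> S}" and ?B = "{S\<in>\<S>. s \<in> S \<and> t \<notin> S}"
    let ?D = "\<lambda>S. \<integral>y. w (s, S) (a, y) * (\<Prod>v\<in>S - {s}. w (v, S) (z v, y)) \<partial>\<nu>"
    have bij: "bij_betw (\<lambda>S. insert s (S - {t})) ?A ?B"
    proof (rule bij_betwI[where g = "\<lambda>S. insert t (S - {s})"])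
      show "(\<lambda>S. insert s (S - {t})) \<in> ?A \<rightarrow> ?B"
        using st closed transpose_image_swap[of s _ t] by auto
      show "(\<lambda>S. insert t (S - {s})) \<in> ?B \<rightarrow> ?A"
        using st closed transpose_image_swap[of t _ s]
        by (auto simp: Transposition.transpose_commute)
    qed (use st in auto)
    have "(\<Prod>S\<in>?A. \<integral>y. (w \<circ> fold_edge s t) (t, S) (a, y) *
           (\<Prod>v\<in>S - {t}. (w \<circ> fold_edge s t) (v, S) (z v, y)) \<partial>\<nu>)
        = (\<Prod>S\<in>?A. ?D (insert s (S - {t})))"
    proof (intro prod.cong refl Bochner_Integration.integral_cong arg_cong2[where f = "(*)"])
      fix S y assume S: "S \<in> ?A"
      then show "(w \<circ> fold_edge s t) (t, S) (a, y) = w (s, insert s (S - {t})) (a, y)"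
        by (simp add: fold_edge_swap)
      show "S - {t} = insert s (S - {t}) - {s}" using S by auto
      fix v assume "v \<in> insert s (S - {t}) - {s}"
      then show "(w \<circ> fold_edge s t) (v, S) (z v, y) = w (v, insert s (S - {t})) (z v, y)"
        using S by (simp add: fold_edge_swap Transposition.transpose_def)
    qed
    also have "\<dots> = prod ?D ?B" by (rule prod.reindex_bij_betw[OF bij])
    finally show "\<alpha> (w \<circ> fold_edge s t) t s z a = \<alpha> w s t z a" by (simp add: \<alpha>_def)
  qed
qed

private lemma fold_\<rho>:
  assumes "s \<in> S" "t \<in> S"
  shows "\<rho> (w \<circ> fold_edge s t) s t z S = \<rho> w s t z S"
  using assms by (intro ext) (auto simp: \<rho>_def fold_edge_id intro!: prod.cong)

private lemma fold_\<phi>: "\<phi> (w \<circ> fold_edge s t) s t z = \<phi> w s t z"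
proof -
  have "(\<Prod>v\<in>S. w (fold_edge s t (v, S)) (z v, y)) = (\<Prod>v\<in>S. w (v, S) (z v, y))"
    if "s \<notin> S" "t \<notin> S" for S y
    using that by (intro prod.cong refl) (simp add: fold_edge_id2)
  then show ?thesis by (auto simp: \<phi>_def intro!: prod.cong)
qed

private lemma swap_sym:
  "\<phi> w s t z = \<phi> w t s z" "\<rho> w s t z = \<rho> w t s z"
  by (auto simp: \<phi>_def \<rho>_def insert_commute conj_commute fun_eq_iff)

text \<open>After folding, both coordinates carry the \<open>\<alpha>\<close> of the side that is
  kept, and in a set containing both \<open>s\<close> and \<open>t\<close> the weight of the kept
  vertex appears at both places. So the two foldings produce the two square terms of
  \<open>reflection_inequality\<close>.\<close>

private lemma inner_fold:
  assumes st: "s \<in> V" "t \<in> V" "s \<noteq> t"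
    and closed: "\<forall>S\<in>\<S>. Transposition.transpose s t ` S \<in> \<S>"
  shows "inner (w \<circ> fold_edge s t) s t z = (\<integral>a. \<integral>b. \<alpha> w s t z a * \<alpha> w s t z b *
      (\<Prod>S\<in>{S\<in>\<S>. s \<in> S \<and> t \<in> S}. \<integral>y. \<rho> w s t z S y * w (s, S) (a, y) * w (s, S) (b, y) \<partial>\<nu>) \<partial>\<mu> \<partial>\<mu>)"
    and "inner (w \<circ> fold_edge t s) s t z = (\<integral>a. \<integral>b. \<alpha> w t s z a * \<alpha> w t s z b *
      (\<Prod>S\<in>{S\<in>\<S>. s \<in> S \<and> t \<in> S}. \<integral>y. \<rho> w s t z S y * w (t, S) (a, y) * w (t, S) (b, y) \<partial>\<nu>) \<partial>\<mu> \<partial>\<mu>)"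
proof -
  have closed': "\<forall>S\<in>\<S>. Transposition.transpose t s ` S \<in> \<S>"
    using closed by (simp add: Transposition.transpose_commute)
  show "inner (w \<circ> fold_edge s t) s t z = (\<integral>a. \<integral>b. \<alpha> w s t z a * \<alpha> w s t z b *
      (\<Prod>S\<in>{S\<in>\<S>. s \<in> S \<and> t \<in> S}. \<integral>y. \<rho> w s t z S y * w (s, S) (a, y) * w (s, S) (b, y) \<partial>\<nu>) \<partial>\<mu> \<partial>\<mu>)"
    using st unfolding inner_def fold_\<alpha>[OF st closed]
    by (intro Bochner_Integration.integral_cong refl arg_cong2[where f = "(*)"] prod.cong)
       (auto simp: fold_\<rho> fold_edge_id fold_edge_both)
  show "inner (w \<circ> fold_edge t s) s t z = (\<integral>a. \<integral>b. \<alpha> w t s z a * \<alpha> w t s z b *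
      (\<Prod>S\<in>{S\<in>\<S>. s \<in> S \<and> t \<in> S}. \<integral>y. \<rho> w s t z S y * w (t, S) (a, y) * w (t, S) (b, y) \<partial>\<nu>) \<partial>\<mu> \<partial>\<mu>)"
    using st unfolding inner_def fold_\<alpha>[OF st(2,1) st(3)[symmetric] closed']
    by (intro Bochner_Integration.integral_cong refl arg_cong2[where f = "(*)"] prod.cong)
       (auto simp: swap_sym(2)[of _ s t] fold_\<rho> fold_edge_id fold_edge_both)
qed

text \<open>For fixed values \<open>z\<close> of the other coordinates this is the reflection
  inequality for \<open>inner\<close>, multiplied by the nonnegative factor \<open>\<phi>\<close>,
  which both foldings leave unchanged. Integrating over \<open>z\<close> gives the claim.\<close>

lemma incidence_integral_fold:
  assumes st: "s \<in> V" "t \<in> V" "s \<noteq> t"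
    and closed: "\<forall>S\<in>\<S>. Transposition.transpose s t ` S \<in> \<S>"
    and w: "\<And>e. nbm (\<mu> \<Otimes>\<^sub>M \<nu>) (w e)"
  shows "2 * incidence_integral \<mu> \<nu> V F \<S> w
    \<le> incidence_integral \<mu> \<nu> V F \<S> (w \<circ> fold_edge s t)
     + incidence_integral \<mu> \<nu> V F \<S> (w \<circ> fold_edge t s)"
proof -
  let ?P = "\<Pi>\<^sub>M v\<in>V - {s, t}. \<mu>"
  let ?g = "\<lambda>w z. \<phi> w s t z * inner w s t z"
  interpret P: prob_space ?P by (rule prob_space_PiM_const[OF mu])
  have w': "\<And>e. nbm (\<mu> \<Otimes>\<^sub>M \<nu>) ((w \<circ> fold_edge s t) e)" "\<And>e. nbm (\<mu> \<Otimes>\<^sub>M \<nu>) ((w \<circ> fold_edge t s) e)"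
    using w by simp_all
  have int: "integrable ?P (?g u)" if "\<And>e. nbm (\<mu> \<Otimes>\<^sub>M \<nu>) (u e)" for u
    by (intro nbm_integrable P.finite_measure_axioms incidence_integral_split st that)
  have "2 * (\<integral>z. ?g w z \<partial>?P) = (\<integral>z. 2 * ?g w z \<partial>?P)" by simp
  also have "\<dots> \<le> (\<integral>z. ?g (w \<circ> fold_edge s t) z + ?g (w \<circ> fold_edge t s) z \<partial>?P)"
  proof (intro integral_mono Bochner_Integration.integrable_add int w' integrable_mult_right w)
    fix z assume z: "z \<in> space ?P"
    have zv: "z v \<in> space \<mu>" if "v \<in> V" "v \<noteq> s" "v \<noteq> t" for v
      using z that by (auto simp: space_PiM PiE_iff)
    have sec: "nbm \<nu> (\<lambda>y. w e (z v, y))" if "v \<in> V" "v \<noteq> s" "v \<noteq> t" for v e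
      by (rule nbm_section[OF w zv[OF that]])
    have \<alpha>: "nbm \<mu> (\<alpha> w p q z)" if "{p, q} = {s, t}" for p q
      unfolding \<alpha>_def using that
      by (intro nbm_mult F nbm_prod nbm_integral nu w nbm_comp[OF sec] measurable_snd nbm_comp[OF w]
          measurable_Pair measurable_fst)
        (use \<S>(2) in \<open>auto simp: doubleton_eq_iff subset_iff\<close>)
    have \<rho>: "nbm \<nu> (\<rho> w s t z S)" if "S \<in> \<S>" for S
      unfolding \<rho>_def using \<S>(2)[OF that] by (intro nbm_prod sec) auto
    have \<phi>: "0 \<le> \<phi> w s t z"
      unfolding \<phi>_def
      by (intro mult_nonneg_nonneg prod_nonneg ballI nbm_nonneg[OF F] zv
          nbm_integral_nonneg nbm_prod sec) (use \<S>(2) in auto)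
    have "2 * inner w s t z \<le> inner (w \<circ> fold_edge s t) s t z + inner (w \<circ> fold_edge t s) s t z"
      unfolding inner_fold[OF st closed] unfolding inner_def
      using \<S>(1) by (intro reflection_inequality mu nu \<alpha> \<rho> w) auto
    then have "\<phi> w s t z * (2 * inner w s t z)
        \<le> \<phi> w s t z * (inner (w \<circ> fold_edge s t) s t z + inner (w \<circ> fold_edge t s) s t z)"
      using \<phi> by (rule mult_left_mono)
    moreover have "\<phi> (w \<circ> fold_edge t s) s t z = \<phi> w s t z"
      using fold_\<phi>[of w t s z] by (simp add: swap_sym(1)[of _ t s])
    ultimately show "2 * ?g w z \<le> ?g (w \<circ> fold_edge s t) z + ?g (w \<circ> fold_edge t s) z"
      by (simp add: fold_\<phi> algebra_simps)
  qed
  also have "\<dots> = (\<integral>z. ?g (w \<circ> fold_edge s t) z \<partial>?P) + (\<integral>z. ?g (w \<circ> fold_edge t s) z \<partial>?P)"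
    by (intro Bochner_Integration.integral_add int w')
  finally show ?thesis
    using incidence_integral_split(1)[OF st, of w] incidence_integral_split(1)[OF st, of "w \<circ> fold_edge s t"]
      incidence_integral_split(1)[OF st, of "w \<circ> fold_edge t s"] w w' by simp
qed

end

subsection \<open>Percolation of incidence sets\<close>

definition incidences :: "'v set \<Rightarrow> nat set \<Rightarrow> ('v \<times> 'v set) set" where
  "incidences V J = {(v, S). v \<in> S \<and> S \<subseteq> V \<and> card S \<in> J}"

lemma finite_incidences: "finite V \<Longrightarrow> finite (incidences V J)"
  by (rule finite_subset[of _ "V \<times> Pow V"]) (auto simp: incidences_def)

lemma transpose_image_subset:
  "s \<in> V \<Longrightarrow> t \<in> V \<Longrightarrow> S \<subseteq> V \<Longrightarrow> Transposition.transpose s t ` S \<subseteq> V"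
  by (auto simp: Transposition.transpose_def)

lemma card_transpose_image [simp]: "card (Transposition.transpose s t ` S) = card S"
  by (rule card_image) (rule inj_on_subset[OF inj_transpose subset_UNIV])

text \<open>A transposition of two elements of \<open>V\<close> preserves inclusion in
  \<open>V\<close>, cardinality and membership, so a folding keeps every incidence at its
  level.\<close>

lemma fold_edge_incidences:
  "s \<in> V \<Longrightarrow> t \<in> V \<Longrightarrow> fold_edge s t e \<in> incidences V J \<longleftrightarrow> e \<in> incidences V J"
  if "snd e \<subseteq> V" "fst e \<in> snd e"
  using that transpose_image_subset[of s V t "snd e"]
  by (cases e) (auto simp: incidences_def fold_edge_def)

text \<open>Foldings turn maximisers of \<open>T\<close> into maximisers. Fix an incidence
  \<open>(v, S)\<close> in a nonempty maximiser \<open>C0\<close>. Foldings that fix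
  \<open>(v, S)\<close> can carry any given incidence to it, and composing them yields a map
  \<open>R\<close> that collapses all of \<open>E\<close> to \<open>(v, S)\<close>. The preimage of
  \<open>C0\<close> under \<open>R\<close> is then \<open>E\<close>, and it is still a
  maximiser.\<close>

lemma percolation:
  fixes T :: "('v \<times> 'v set) set \<Rightarrow> real" and V :: "'v set" and k :: nat
  defines "E \<equiv> incidences V {k}"
  assumes V: "finite V" and e0: "(v0, S0) \<in> E"
    and fold: "\<And>C s t. C \<subseteq> E \<Longrightarrow> s \<in> V \<Longrightarrow> t \<in> V \<Longrightarrow> s \<noteq> t \<Longrightarrow>
      2 * T C \<le> T {e\<in>E. fold_edge s t e \<in> C} + T {e\<in>E. fold_edge t s e \<in> C}"
    and base: "\<And>e. e \<in> E \<Longrightarrow> T {} \<le> T {e}"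
  shows "T {} \<le> T E"
proof -
  have finE: "finite E" using V by (simp add: E_def finite_incidences)
  define M where "M = Max (T ` Pow E)"
  have M: "T C \<le> M" if "C \<subseteq> E" for C
    unfolding M_def using finE that by (intro Max_ge) auto
  define maxi where "maxi C \<longleftrightarrow> C \<subseteq> E \<and> T C = M" for C
  \<comment> \<open>Neither folding exceeds the maximum \<open>M\<close>, while their mean is at
    least \<open>M\<close>; hence both attain it.\<close>
  have maxi_fold: "maxi {e\<in>E. fold_edge s t e \<in> C}"
    if "maxi C" "s \<in> V" "t \<in> V" "s \<noteq> t" for C s t
    using fold[of C s t] that M[of "{e\<in>E. fold_edge s t e \<in> C}"] M[of "{e\<in>E. fold_edge t s e \<in> C}"]
    unfolding maxi_def by fastforce
  have "M \<in> T ` Pow E" unfolding M_def using finE by (intro Max_in) auto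
  then obtain C1 where C1: "maxi C1" by (auto simp: maxi_def)
  \<comment> \<open>If the maximiser found is empty, \<open>base\<close> makes a singleton a
    maximiser as well, and from there the folding can start.\<close>
  have "\<exists>C. maxi C \<and> C \<noteq> {}"
  proof (cases "C1 = {}")
    case True
    then have "maxi {(v0, S0)}" using C1 base[OF e0] M[of "{(v0, S0)}"] e0 by (auto simp: maxi_def)
    then show ?thesis by blast
  qed (use C1 in blast)
  then obtain C0 v S where C0: "maxi C0" and e: "(v, S) \<in> C0" by auto
  then have vS: "v \<in> S" "S \<subseteq> V" "card S = k" "finite S"
    using V by (auto simp: maxi_def E_def incidences_def dest: finite_subset)
  \<comment> \<open>Such maps act on maximisers by taking preimages. All three conditions survive
    composition, so it is enough to find them among single foldings.\<close>
  define good where "good R \<longleftrightarrow> (\<forall>e\<in>E. R e \<in> E) \<and> R (v, S) = (v, S) \<and>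
      (\<forall>C. maxi C \<longrightarrow> maxi {e\<in>E. R e \<in> C})" for R
  have good_comp: "good (R \<circ> R')" if "good R" "good R'" for R R'
  proof -
    have "{e\<in>E. (R \<circ> R') e \<in> C} = {e\<in>E. R' e \<in> {e\<in>E. R e \<in> C}}" for C
      using that by (auto simp: good_def)
    then show ?thesis using that by (auto simp: good_def)
  qed
  have good_id: "good id"
  proof -
    have "{e\<in>E. id e \<in> C} = C" if "maxi C" for C using that by (auto simp: maxi_def)
    then show ?thesis by (simp add: good_def)
  qed
  have good_fold: "good (fold_edge s t)"
    if "s \<in> V" "t \<in> V" "s \<noteq> t" "fold_edge s t (v, S) = (v, S)" for s t
  proof -
    have "fold_edge s t e \<in> E" if "e \<in> E" for e
      using fold_edge_incidences[of e V s t "{k}"] that \<open>s \<in> V\<close> \<open>t \<in> V\<close>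
      by (auto simp: E_def incidences_def)
    then show ?thesis using that maxi_fold by (simp add: good_def)
  qed
  \<comment> \<open>Each fold exchanges some \<open>t\<close> in \<open>U - S\<close> for some
    \<open>s\<close> in \<open>S - U\<close>, which exists because the two sets have the same size;
    it fixes \<open>(v, S)\<close> since \<open>t\<close> is not in \<open>S\<close>. Once
    \<open>U = S\<close>, folding \<open>u\<close> onto \<open>v\<close> finishes.\<close>
  have reach: "\<exists>R. good R \<and> R (u, U) = (v, S)" if "(u, U) \<in> E" for u U
    using that
  proof (induction "card (S - U)" arbitrary: u U rule: less_induct)
    case less
    then have uU: "u \<in> U" "U \<subseteq> V" "card U = k" "finite U"
      using V by (auto simp: E_def incidences_def dest: finite_subset)
    show ?case
    proof (cases "U = S")
      case True
      show ?thesis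
      proof (cases "u = v")
        case False
        have "good (fold_edge v u)"
          using False vS uU True by (intro good_fold) (auto simp: fold_edge_id)
        moreover have "fold_edge v u (u, U) = (v, S)" using True vS uU by (simp add: fold_edge_both)
        ultimately show ?thesis by blast
      qed (use True good_id in \<open>auto intro: exI[of _ id]\<close>)
    next
      case False
      obtain s where s: "s \<in> S" "s \<notin> U" using False vS uU card_subset_eq[of U S] by auto
      obtain t where t: "t \<in> U" "t \<notin> S" using False vS uU card_subset_eq[of S U] by auto
      have st: "s \<in> V" "t \<in> V" "s \<noteq> t" using s t vS uU by auto
      have g: "good (fold_edge s t)" using st t vS by (intro good_fold) (auto simp: fold_edge_id2)
      then have E': "fold_edge s t (u, U) \<in> E" using less.prems by (auto simp: good_def)
      obtain u' where u': "fold_edge s t (u, U) = (u', insert s (U - {t}))"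
        using s t by (simp add: fold_edge_swap)
      have "S - insert s (U - {t}) \<subset> S - U" using s t by auto
      then have "card (S - insert s (U - {t})) < card (S - U)"
        using vS by (intro psubset_card_mono) auto
      then obtain R where "good R" "R (u', insert s (U - {t})) = (v, S)"
        using less.hyps E' u' by metis
      then show ?thesis using good_comp[OF _ g] u' by (intro exI[of _ "R \<circ> fold_edge s t"]) simp
    qed
  qed
  \<comment> \<open>The incidences are collected one at a time: the map that carries the next one to
    \<open>(v, S)\<close> fixes \<open>(v, S)\<close>, so those already collected stay
    there.\<close>
  have "\<exists>R. good R \<and> (\<forall>e\<in>A. R e = (v, S))" if "finite A" "A \<subseteq> E" for A
    using that
  proof (induction A rule: finite_induct)
    case (insert e A)
    then obtain R where R: "good R" "\<forall>e\<in>A. R e = (v, S)" by auto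
    then have "R e \<in> E" using insert by (auto simp: good_def)
    then obtain R' where "good R'" "R' (R e) = (v, S)" using reach[of "fst (R e)" "snd (R e)"] by auto
    moreover then have "R' (v, S) = (v, S)" by (simp add: good_def)
    ultimately show ?case using R good_comp[of R' R] by (intro exI[of _ "R' \<circ> R"]) (simp del: comp_apply add: comp_apply[abs_def])
  qed (use good_id in auto)
  then obtain R where R: "good R" "\<forall>e\<in>E. R e = (v, S)" using finE by blast
  then have "maxi {e\<in>E. R e \<in> C0}" using C0 by (simp add: good_def)
  moreover have "{e\<in>E. R e \<in> C0} = E" using R e by auto
  ultimately have "T E = M" by (simp add: maxi_def)
  then show ?thesis using M[of "{}"] by simp
qed

section \<open>From means to joint integrals, one level at a time\<close>

definition joint_prod :: "'y measure \<Rightarrow> 'v set \<Rightarrow> nat \<Rightarrow> ('x \<times> 'y \<Rightarrow> real) \<Rightarrow> ('v \<Rightarrow> 'x) \<Rightarrow> real" where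
  "joint_prod \<nu> V k W x = (\<Prod>S\<in>{S. S \<subseteq> V \<and> card S = k}. \<integral>y. (\<Prod>v\<in>S. W (x v, y)) \<partial>\<nu>)"

definition split_prod :: "'y measure \<Rightarrow> 'v set \<Rightarrow> nat \<Rightarrow> ('x \<times> 'y \<Rightarrow> real) \<Rightarrow> ('v \<Rightarrow> 'x) \<Rightarrow> real" where
  "split_prod \<nu> V k W x = (\<Prod>S\<in>{S. S \<subseteq> V \<and> card S = k}. \<Prod>v\<in>S. \<integral>y. W (x v, y) \<partial>\<nu>)"

lemma incidence_integral_cong:
  assumes "\<And>v S x y. S \<in> \<S> \<Longrightarrow> v \<in> S \<Longrightarrow> w (v, S) (x, y) = w' (v, S) (x, y)"
  shows "incidence_integral \<mu> \<nu> V F \<S> w = incidence_integral \<mu> \<nu> V F \<S> w'"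
  unfolding incidence_integral_def using assms
  by (intro Bochner_Integration.integral_cong refl arg_cong2[where f = "(*)"] prod.cong) auto

text \<open>The level of an incidence is the size of its set. Off \<open>C\<close> the kernel is
  replaced by its mean, which is constant in the second variable and therefore leaves the integral
  over \<open>y\<close> as a factor.\<close>

definition level_weight :: "'y measure \<Rightarrow> (nat \<Rightarrow> 'x \<times> 'y \<Rightarrow> real) \<Rightarrow> ('v \<times> 'v set) set
    \<Rightarrow> 'v \<times> 'v set \<Rightarrow> 'x \<times> 'y \<Rightarrow> real" where
  "level_weight \<nu> W C e =
    (if e \<in> C then W (card (snd e)) else (\<lambda>p. \<integral>y. W (card (snd e)) (fst p, y) \<partial>\<nu>))"

lemma nbm_level_weight:
  assumes "prob_space \<nu>" "\<And>k. nbm (\<mu> \<Otimes>\<^sub>M \<nu>) (W k)"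
  shows "nbm (\<mu> \<Otimes>\<^sub>M \<nu>) (level_weight \<nu> W C e)"
proof -
  have "nbm \<mu> (\<lambda>x. \<integral>y. W k (x, y) \<partial>\<nu>)" for k
    using assms by (intro nbm_integral) auto
  then have "nbm (\<mu> \<Otimes>\<^sub>M \<nu>) (\<lambda>p. \<integral>y. W k (fst p, y) \<partial>\<nu>)" for k
    by (rule nbm_comp) simp
  then show ?thesis using assms by (simp add: level_weight_def)
qed

text \<open>Percolation inside level \<open>k\<close>, with the incidences at the levels in
  \<open>J\<close> present throughout.\<close>

lemma level_step:
  fixes K :: "nat set"
  assumes mu: "prob_space \<mu>" and nu: "prob_space \<nu>" and V: "finite V" and F: "nbm \<mu> F"
    and W: "\<And>k. nbm (\<mu> \<Otimes>\<^sub>M \<nu>) (W k)" and k: "k \<notin> J"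
  defines "T \<equiv> \<lambda>C. incidence_integral \<mu> \<nu> V F {S. S \<subseteq> V \<and> card S \<in> K} (level_weight \<nu> W C)"
  shows "T (incidences V J) \<le> T (incidences V (insert k J))"
proof (cases "incidences V {k} = {}")
  case True
  then have "incidences V (insert k J) = incidences V J" by (auto simp: incidences_def)
  then show ?thesis by simp
next
  case False
  let ?E = "incidences V {k}" and ?J = "incidences V J" and ?\<S> = "{S. S \<subseteq> V \<and> card S \<in> K}"
  obtain v0 S0 where "(v0, S0) \<in> ?E" using False by auto
  have "T (?J \<union> {}) \<le> T (?J \<union> ?E)"
  proof (rule percolation[where T = "\<lambda>C. T (?J \<union> C)"])
    show "finite V" "(v0, S0) \<in> ?E" by fact+
  next
    fix C s t assume C: "C \<subseteq> ?E" and st: "s \<in> V" "t \<in> V" "s \<noteq> t"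
    \<comment> \<open>Since a folding preserves levels, precomposing the weight with it amounts to
      taking the preimage of \<open>C\<close> inside level \<open>k\<close> and leaving
      \<open>?J\<close> as it is.\<close>
    have eq: "incidence_integral \<mu> \<nu> V F ?\<S> (level_weight \<nu> W (?J \<union> C) \<circ> fold_edge p q)
        = T (?J \<union> {e\<in>?E. fold_edge p q e \<in> C})" if pq: "p \<in> V" "q \<in> V" for p q
      unfolding T_def
    proof (rule incidence_integral_cong)
      fix v S x y assume S: "S \<in> ?\<S>" "v \<in> S"
      then have 1: "fold_edge p q (v, S) \<in> incidences V I \<longleftrightarrow> (v, S) \<in> incidences V I" for I
        using fold_edge_incidences[of "(v, S)" V p q I] pq by simp
      have 2: "card (snd (fold_edge p q (v, S))) = card S" by (simp add: fold_edge_def)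
      have "fold_edge p q (v, S) \<in> ?J \<union> C \<longleftrightarrow> (v, S) \<in> ?J \<union> {e\<in>?E. fold_edge p q e \<in> C}"
        using 1[of J] 1[of "{k}"] C by auto
      then show "(level_weight \<nu> W (?J \<union> C) \<circ> fold_edge p q) (v, S) (x, y)
          = level_weight \<nu> W (?J \<union> {e\<in>?E. fold_edge p q e \<in> C}) (v, S) (x, y)"
        using 2 by (simp add: level_weight_def)
    qed
    have "2 * T (?J \<union> C) \<le> incidence_integral \<mu> \<nu> V F ?\<S> (level_weight \<nu> W (?J \<union> C) \<circ> fold_edge s t)
        + incidence_integral \<mu> \<nu> V F ?\<S> (level_weight \<nu> W (?J \<union> C) \<circ> fold_edge t s)"
      unfolding T_def using V st transpose_image_subset[OF st(1,2)]
      by (intro incidence_integral_fold mu nu F nbm_level_weight W) auto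
    then show "2 * T (?J \<union> C) \<le> T (?J \<union> {e\<in>?E. fold_edge s t e \<in> C}) + T (?J \<union> {e\<in>?E. fold_edge t s e \<in> C})"
      using eq st by simp
  next
    fix e assume e: "e \<in> ?E"
    obtain u U where uU: "e = (u, U)" "u \<in> U" "U \<subseteq> V" "card U = k" using e by (auto simp: incidences_def)
    have fU: "finite U" using uU V finite_subset by blast
    \<comment> \<open>Only the factor of \<open>U\<close> can differ. As \<open>k\<close> is not in
      \<open>J\<close>, all incidences of \<open>U\<close> other than \<open>(u, U)\<close> carry
      constants in \<open>y\<close>, and integrating the one remaining kernel gives exactly its
      mean.\<close>
    have *: "(\<integral>y. (\<Prod>v\<in>S. level_weight \<nu> W (?J \<union> {}) (v, S) (x v, y)) \<partial>\<nu>)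
        = (\<integral>y. (\<Prod>v\<in>S. level_weight \<nu> W (?J \<union> {e}) (v, S) (x v, y)) \<partial>\<nu>)" for S x
    proof (cases "S = U")
      case False
      then show ?thesis by (simp add: level_weight_def uU)
    next
      case True
      define d where "d v = (\<integral>y. W k (x v, y) \<partial>\<nu>)" for v
      have [simp]: "(v, U) \<notin> ?J" for v using uU k by (auto simp: incidences_def)
      have "(\<Prod>v\<in>U. level_weight \<nu> W (?J \<union> {}) (v, U) (x v, y)) = (\<Prod>v\<in>U. d v)" for y
        using uU by (simp add: level_weight_def d_def)
      moreover have "(\<Prod>v\<in>U. level_weight \<nu> W (?J \<union> {e}) (v, U) (x v, y))
          = W k (x u, y) * (\<Prod>v\<in>U - {u}. d v)" for y
        using uU fU
        by (subst prod.remove[of U u]) (auto simp: level_weight_def d_def intro!: prod.cong)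
      moreover have "(\<integral>y. W k (x u, y) * (\<Prod>v\<in>U - {u}. d v) \<partial>\<nu>) = (\<Prod>v\<in>U. d v)"
        using uU fU by (subst prod.remove[of U u]) (auto simp: d_def)
      ultimately show ?thesis using True prob_space.prob_space[OF nu] by simp
    qed
    show "T (?J \<union> {}) \<le> T (?J \<union> {e})"
      unfolding T_def incidence_integral_def * by simp
  qed
  moreover have "incidences V (insert k J) = ?J \<union> ?E" by (auto simp: incidences_def)
  ultimately show ?thesis by simp
qed

text \<open>The levels of \<open>J' - J\<close> are added one by one with \<open>level_step\<close>.
  Sorting the sets by size turns the incidence integral into the product over \<open>K\<close> of
  joint and split products.\<close>

lemma level_mono:
  assumes mu: "prob_space \<mu>" and nu: "prob_space \<nu>" and V: "finite V" and F: "nbm \<mu> F"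
    and W: "\<And>k. nbm (\<mu> \<Otimes>\<^sub>M \<nu>) (W k)" and K: "finite K" "J' \<subseteq> K" "J \<subseteq> J'"
  defines "T \<equiv> \<lambda>J. \<integral>x. (\<Prod>v\<in>V. F (x v)) *
      (\<Prod>k\<in>K. if k \<in> J then joint_prod \<nu> V k (W k) x else split_prod \<nu> V k (W k) x) \<partial>(\<Pi>\<^sub>M v\<in>V. \<mu>)"
  shows "T J \<le> T J'"
proof -
  let ?\<S> = "{S. S \<subseteq> V \<and> card S \<in> K}"
  let ?T = "\<lambda>C. incidence_integral \<mu> \<nu> V F ?\<S> (level_weight \<nu> W C)"
  have eq: "?T (incidences V J) = T J" if "J \<subseteq> K" for J
    unfolding T_def incidence_integral_def
  proof (intro Bochner_Integration.integral_cong refl arg_cong2[where f = "(*)"])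
    fix x
    let ?D = "\<lambda>S. \<integral>y. (\<Prod>v\<in>S. level_weight \<nu> W (incidences V J) (v, S) (x v, y)) \<partial>\<nu>"
    have "?\<S> = (\<Union>k\<in>K. {S. S \<subseteq> V \<and> card S = k})" by auto
    then have "prod ?D ?\<S> = (\<Prod>k\<in>K. prod ?D {S. S \<subseteq> V \<and> card S = k})"
      using K V by (simp only:) (subst prod.UNION_disjoint, auto)
    also have "\<dots> = (\<Prod>k\<in>K. if k \<in> J then joint_prod \<nu> V k (W k) x else split_prod \<nu> V k (W k) x)"
    proof (intro prod.cong refl)
      fix k
      have "?D S = (if k \<in> J then \<integral>y. (\<Prod>v\<in>S. W k (x v, y)) \<partial>\<nu> else \<Prod>v\<in>S. \<integral>y. W k (x v, y) \<partial>\<nu>)"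
        if "S \<subseteq> V" "card S = k" for S
        using that by (auto simp: level_weight_def incidences_def prob_space.prob_space[OF nu]
            intro!: Bochner_Integration.integral_cong prod.cong)
      then show "prod ?D {S. S \<subseteq> V \<and> card S = k} = (if k \<in> J then joint_prod \<nu> V k (W k) x else split_prod \<nu> V k (W k) x)"
        by (auto simp: joint_prod_def split_prod_def intro!: prod.cong)
    qed
    finally show "prod ?D ?\<S> = \<dots>" .
  qed
  have "?T (incidences V J) \<le> ?T (incidences V (J \<union> I))" if "finite I" "I \<inter> J = {}" for I
    using that
  proof (induction I rule: finite_induct)
    case (insert k I)
    then have "?T (incidences V (J \<union> I)) \<le> ?T (incidences V (insert k (J \<union> I)))"
      by (intro level_step mu nu V F W) auto
    with insert show ?case by simp
  qed simp
  from this[of "J' - J"] have "?T (incidences V J) \<le> ?T (incidences V J')"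
    using K finite_subset[of J' K] by (simp add: Un_absorb1 Un_Diff_cancel Diff_disjoint[THEN trans[OF Int_commute]])
  then show ?thesis using eq[of J] eq[of J'] K by auto
qed

subsection \<open>Exponents at least one\<close>

lemma card_subsets_containing:
  assumes "finite V" "v \<in> V" "k \<ge> 1"
  shows "card {S. S \<subseteq> V \<and> card S = k \<and> v \<in> S} = (card V - 1) choose (k - 1)"
proof -
  have "bij_betw (insert v) {T. T \<subseteq> V - {v} \<and> card T = k - 1} {S. S \<subseteq> V \<and> card S = k \<and> v \<in> S}"
  proof (rule bij_betwI[where g = "\<lambda>S. S - {v}"])
    show "insert v \<in> {T. T \<subseteq> V - {v} \<and> card T = k - 1} \<rightarrow> {S. S \<subseteq> V \<and> card S = k \<and> v \<in> S}"
    proof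
      fix T assume T: "T \<in> {T. T \<subseteq> V - {v} \<and> card T = k - 1}"
      then have "finite T" "v \<notin> T" using assms finite_subset[of T V] by auto
      then show "insert v T \<in> {S. S \<subseteq> V \<and> card S = k \<and> v \<in> S}" using T assms by auto
    qed
    show "(\<lambda>S. S - {v}) \<in> {S. S \<subseteq> V \<and> card S = k \<and> v \<in> S} \<rightarrow> {T. T \<subseteq> V - {v} \<and> card T = k - 1}"
      by auto
  qed auto
  then have "card {S. S \<subseteq> V \<and> card S = k \<and> v \<in> S} = card {T. T \<subseteq> V - {v} \<and> card T = k - 1}"
    by (simp add: bij_betw_same_card)
  also have "\<dots> = (card V - 1) choose (k - 1)"
    using assms by (subst n_subsets) auto
  finally show ?thesis .
qed

text \<open>Exchanging the two products, each vertex occurs once for every \<open>k\<close>-set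
  through it. The split product is thus a product of one-variable functions and can be absorbed into
  the vertex weight.\<close>

lemma split_prod_eq:
  assumes "finite V" "k \<ge> 1"
  shows "split_prod \<nu> V k W x = (\<Prod>v\<in>V. (\<integral>y. W (x v, y) \<partial>\<nu>) ^ ((card V - 1) choose (k - 1)))"
proof -
  let ?D = "\<lambda>v. \<integral>y. W (x v, y) \<partial>\<nu>" and ?A = "{S. S \<subseteq> V \<and> card S = k}"
  have "split_prod \<nu> V k W x = (\<Prod>S\<in>?A. \<Prod>v\<in>{v\<in>V. v \<in> S}. ?D v)"
    unfolding split_prod_def by (intro prod.cong refl) auto
  also have "\<dots> = (\<Prod>v\<in>V. \<Prod>S\<in>{S\<in>?A. v \<in> S}. ?D v)"
    using assms by (intro prod.swap_restrict) auto
  also have "\<dots> = (\<Prod>v\<in>V. ?D v ^ ((card V - 1) choose (k - 1)))"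
  proof (intro prod.cong refl)
    fix v assume "v \<in> V"
    have "{S\<in>?A. v \<in> S} = {S. S \<subseteq> V \<and> card S = k \<and> v \<in> S}" by auto
    then show "(\<Prod>S\<in>{S\<in>?A. v \<in> S}. ?D v) = ?D v ^ ((card V - 1) choose (k - 1))"
      using card_subsets_containing[OF assms(1) \<open>v \<in> V\<close> assms(2)] by simp
  qed
  finally show ?thesis .
qed

text \<open>For positive arguments this is \<open>exp u \<ge> 1 + u\<close> with \<open>u = \<Sum> b k * ln (A k / B k)\<close>, followed by
  \<open>ln z \<ge> 1 - 1 / z\<close>.\<close>

lemma prod_powr_tangent:
  fixes A B b :: "'k \<Rightarrow> real"
  assumes K: "finite K" and nn: "\<And>k. k \<in> K \<Longrightarrow> 0 \<le> A k" "\<And>k. k \<in> K \<Longrightarrow> 0 \<le> B k" "\<And>k. k \<in> K \<Longrightarrow> 0 \<le> b k"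
  shows "(1 + sum b K) * (\<Prod>k\<in>K. B k powr b k * A k)
    \<le> (\<Prod>k\<in>K. A k powr (b k + 1)) + (\<Sum>k\<in>K. b k * (\<Prod>j\<in>K. B j powr b j * (if j = k then B j else A j)))"
\<comment> \<open>In the degenerate case the left-hand side is \<open>0\<close>: if
  \<open>B k = 0\<close>, then \<open>B k powr b k\<close> vanishes even for
  \<open>b k = 0\<close>.\<close>
proof (cases "\<exists>k\<in>K. A k = 0 \<or> B k = 0")
  case True
  then have "(\<Prod>k\<in>K. B k powr b k * A k) = 0" using K by (intro prod_zero) auto
  moreover have "0 \<le> (\<Prod>k\<in>K. A k powr (b k + 1)) + (\<Sum>k\<in>K. b k * (\<Prod>j\<in>K. B j powr b j * (if j = k then B j else A j)))"
    by (intro add_nonneg_nonneg prod_nonneg sum_nonneg mult_nonneg_nonneg) (auto intro: nn)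
  ultimately show ?thesis by (simp only: mult_zero_right)
next
  case False
  then have pos: "A k > 0" "B k > 0" if "k \<in> K" for k using nn that by (metis less_eq_real_def)+
  let ?P = "\<Prod>k\<in>K. B k powr b k * A k"
  have P: "?P > 0" by (intro prod_pos mult_pos_pos) (auto dest: pos)
  have 1: "(\<Prod>j\<in>K. B j powr b j * (if j = k then B j else A j)) = ?P * (B k / A k)" if "k \<in> K" for k
  proof -
    have "(\<Prod>j\<in>K - {k}. B j powr b j * (if j = k then B j else A j)) = (\<Prod>j\<in>K - {k}. B j powr b j * A j)"
      by (intro prod.cong) auto
    then show ?thesis using K that pos[OF that] by (simp add: prod.remove[of K k])
  qed
  have "(\<Prod>k\<in>K. A k powr (b k + 1)) = ?P * (\<Prod>k\<in>K. (A k / B k) powr b k)"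
    unfolding prod.distrib[symmetric]
  proof (intro prod.cong refl)
    fix k assume "k \<in> K"
    then show "A k powr (b k + 1) = B k powr b k * A k * (A k / B k) powr b k"
      using pos[of k] by (simp add: powr_divide powr_add)
  qed
  also have "(\<Prod>k\<in>K. (A k / B k) powr b k) = exp (\<Sum>k\<in>K. b k * ln (A k / B k))"
    using K pos by (subst exp_sum) (force simp: powr_def intro!: prod.cong)+
  finally have 2: "(\<Prod>k\<in>K. A k powr (b k + 1)) = ?P * exp (\<Sum>k\<in>K. b k * ln (A k / B k))" .
  have "(\<Sum>k\<in>K. b k * (1 - B k / A k)) \<le> (\<Sum>k\<in>K. b k * ln (A k / B k))"
  proof (intro sum_mono mult_left_mono nn)
    fix k assume k: "k \<in> K"
    have "ln (B k / A k) \<le> B k / A k - 1" using pos[OF k] by (intro ln_le_minus_one) simp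
    moreover have "ln (A k / B k) = - ln (B k / A k)" using pos[OF k] by (simp add: ln_div)
    ultimately show "1 - B k / A k \<le> ln (A k / B k)" by simp
  qed
  then have "1 + (\<Sum>k\<in>K. b k * (1 - B k / A k)) \<le> exp (\<Sum>k\<in>K. b k * ln (A k / B k))"
    using exp_ge_add_one_self[of "\<Sum>k\<in>K. b k * ln (A k / B k)"] by linarith
  then have "?P * (1 + (\<Sum>k\<in>K. b k * (1 - B k / A k))) \<le> (\<Prod>k\<in>K. A k powr (b k + 1))"
    unfolding 2 using P by (intro mult_left_mono) auto
  moreover have "(\<Sum>k\<in>K. b k * (\<Prod>j\<in>K. B j powr b j * (if j = k then B j else A j)))
      = ?P * (\<Sum>k\<in>K. b k * (B k / A k))"
    unfolding sum_distrib_left by (intro sum.cong refl) (simp add: 1)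
  ultimately show ?thesis by (simp add: algebra_simps sum_subtractf)
qed

lemma nbm_degree:
  "prob_space \<nu> \<Longrightarrow> nbm (\<mu> \<Otimes>\<^sub>M \<nu>) W \<Longrightarrow> nbm \<mu> (\<lambda>x. \<integral>y. W (x, y) \<partial>\<nu>)"
  by (rule nbm_integral) auto

lemma nbm_power: "nbm M f \<Longrightarrow> nbm M (\<lambda>x. f x ^ n)"
  by (induction n) (auto intro: nbm_const nbm_mult)

lemma nbm_joint_prod:
  assumes "prob_space \<nu>" "nbm (\<mu> \<Otimes>\<^sub>M \<nu>) W"
  shows "nbm (\<Pi>\<^sub>M v\<in>V. \<mu>) (joint_prod \<nu> V k W)"
  unfolding joint_prod_def
  using nbm_incidence_factor[OF assms(1) _ assms(2), where g = "\<lambda>_. 1"]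
  by (intro nbm_prod) (auto simp: nbm_const)

lemma nbm_split_prod:
  assumes "prob_space \<nu>" "nbm (\<mu> \<Otimes>\<^sub>M \<nu>) W"
  shows "nbm (\<Pi>\<^sub>M v\<in>V. \<mu>) (split_prod \<nu> V k W)"
  unfolding split_prod_def
  by (intro nbm_prod nbm_component[OF nbm_degree[OF assms]]) auto

text \<open>With the vertex weight enlarged by \<open>B k powr (a k - 1)\<close>, let
  \<open>T J\<close> be the integral with joint products at the levels in \<open>J\<close> and split
  ones elsewhere. Then \<open>T {}\<close> is the left-hand side. Integrating the tangent bound
  gives \<open>(1 + sum b K) * T K\<close> at most the right-hand side plus the sum of
  \<open>b k * T (K - {k})\<close>, and monotonicity of \<open>T\<close> cancels that sum.\<close>

lemma integral_split_le_joint: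
  assumes mu: "prob_space \<mu>" and nu: "prob_space \<nu>" and V: "finite V" and F: "nbm \<mu> F"
    and W: "\<And>k. nbm (\<mu> \<Otimes>\<^sub>M \<nu>) (W k)" and K: "finite K" "0 \<notin> K" and a: "\<And>k. k \<in> K \<Longrightarrow> 1 \<le> a k"
  shows "(\<integral>x. (\<Prod>v\<in>V. F (x v)) * (\<Prod>k\<in>K. split_prod \<nu> V k (W k) x powr a k) \<partial>(\<Pi>\<^sub>M v\<in>V. \<mu>))
    \<le> (\<integral>x. (\<Prod>v\<in>V. F (x v)) * (\<Prod>k\<in>K. joint_prod \<nu> V k (W k) x powr a k) \<partial>(\<Pi>\<^sub>M v\<in>V. \<mu>))"
proof -
  let ?P = "\<Pi>\<^sub>M v\<in>V. \<mu>"
  interpret P: prob_space ?P by (rule prob_space_PiM_const[OF mu])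
  define A where "A k = joint_prod \<nu> V k (W k)" for k
  define B where "B k = split_prod \<nu> V k (W k)" for k
  define b where "b k = a k - 1" for k
  define r where "r x = (\<Prod>v\<in>V. F (x v))" for x
  \<comment> \<open>The share of a single vertex in \<open>B k powr b k\<close>, read off from
    \<open>split_prod_eq\<close>.\<close>
  define F' where "F' x = F x * (\<Prod>k\<in>K. ((\<integral>y. W k (x, y) \<partial>\<nu>) ^ ((card V - 1) choose (k - 1))) powr b k)" for x
  define T where "T J = (\<integral>x. (\<Prod>v\<in>V. F' (x v)) * (\<Prod>k\<in>K. if k \<in> J then A k x else B k x) \<partial>?P)" for J
  define L where "L x = r x * (\<Prod>k\<in>K. A k x powr a k)" for x
  have b: "0 \<le> b k" if "k \<in> K" for k using a[OF that] by (simp add: b_def)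
  have A: "nbm ?P (A k)" for k unfolding A_def by (intro nbm_joint_prod nu W)
  have B: "nbm ?P (B k)" for k unfolding B_def by (intro nbm_split_prod nu W)
  have r: "nbm ?P r" unfolding r_def by (intro nbm_prod nbm_component F)
  have L: "nbm ?P L" unfolding L_def using a by (intro nbm_mult r nbm_prod nbm_powr A) force
  have F': "nbm \<mu> F'" unfolding F'_def by (intro nbm_mult F nbm_prod nbm_powr nbm_power nbm_degree nu W b)
  have F'_eq: "(\<Prod>v\<in>V. F' (x v)) = r x * (\<Prod>k\<in>K. B k x powr b k)" for x
  proof -
    have "(\<Prod>v\<in>V. F' (x v)) = r x * (\<Prod>k\<in>K. \<Prod>v\<in>V. ((\<integral>y. W k (x v, y) \<partial>\<nu>) ^ ((card V - 1) choose (k - 1))) powr b k)"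
      unfolding F'_def r_def prod.distrib by (simp only: prod.swap[of _ V K])
    also have "(\<Prod>k\<in>K. \<Prod>v\<in>V. ((\<integral>y. W k (x v, y) \<partial>\<nu>) ^ ((card V - 1) choose (k - 1))) powr b k)
        = (\<Prod>k\<in>K. B k x powr b k)"
    proof (intro prod.cong refl)
      fix k assume "k \<in> K"
      with K have "k \<ge> 1" by (cases k) auto
      then show "(\<Prod>v\<in>V. ((\<integral>y. W k (x v, y) \<partial>\<nu>) ^ ((card V - 1) choose (k - 1))) powr b k) = B k x powr b k"
        by (simp add: B_def split_prod_eq[OF V] prod_powr_distrib)
    qed
    finally show ?thesis .
  qed
  have T_eq: "T J = (\<integral>x. r x * (\<Prod>k\<in>K. B k x powr b k * (if k \<in> J then A k x else B k x)) \<partial>?P)" for J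
    unfolding T_def F'_eq by (simp add: prod.distrib mult.assoc)
  have nT: "nbm ?P (\<lambda>x. r x * (\<Prod>k\<in>K. B k x powr b k * (if k \<in> J then A k x else B k x)))" for J
  proof (intro nbm_mult r nbm_prod nbm_powr B b)
    show "nbm ?P (\<lambda>x. if k \<in> J then A k x else B k x)" for k using A B by (cases "k \<in> J") auto
  qed
  have mono: "T J \<le> T K" if "J \<subseteq> K" for J
    unfolding T_def A_def B_def using that by (intro level_mono mu nu V F' W K) auto
  have "(1 + sum b K) * T K = (\<integral>x. (1 + sum b K) * (r x * (\<Prod>k\<in>K. B k x powr b k * A k x)) \<partial>?P)"
    by (simp add: T_eq)
  also have "\<dots> \<le> (\<integral>x. L x + (\<Sum>k\<in>K. b k * (r x * (\<Prod>j\<in>K. B j x powr b j * (if j \<in> K - {k} then A j x else B j x)))) \<partial>?P)"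
  proof (intro nbm_integral_mono P.finite_measure_axioms nbm_add nbm_sum L nbm_mult[OF nbm_const] nT b)
    show "0 \<le> 1 + sum b K" using b by (simp add: sum_nonneg add_nonneg_nonneg)
    show "nbm ?P (\<lambda>x. r x * (\<Prod>k\<in>K. B k x powr b k * A k x))"
      by (intro nbm_mult r nbm_prod nbm_powr A B b)
    fix x assume x: "x \<in> space ?P"
    have "r x * ((1 + sum b K) * (\<Prod>k\<in>K. B k x powr b k * A k x)) \<le> r x * ((\<Prod>k\<in>K. A k x powr (b k + 1)) +
        (\<Sum>k\<in>K. b k * (\<Prod>j\<in>K. B j x powr b j * (if j = k then B j x else A j x))))"
      using x by (intro mult_left_mono prod_powr_tangent K b nbm_nonneg[OF r] nbm_nonneg[OF A] nbm_nonneg[OF B])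
    also have "(\<Sum>k\<in>K. b k * (\<Prod>j\<in>K. B j x powr b j * (if j = k then B j x else A j x)))
        = (\<Sum>k\<in>K. b k * (\<Prod>j\<in>K. B j x powr b j * (if j \<in> K - {k} then A j x else B j x)))"
      by (intro sum.cong arg_cong2[where f = "(*)"] prod.cong refl) auto
    finally show "(1 + sum b K) * (r x * (\<Prod>k\<in>K. B k x powr b k * A k x))
        \<le> L x + (\<Sum>k\<in>K. b k * (r x * (\<Prod>j\<in>K. B j x powr b j * (if j \<in> K - {k} then A j x else B j x))))"
      by (simp add: L_def b_def distrib_left sum_distrib_left mult_ac)
  qed
  also have "\<dots> = integral\<^sup>L ?P L + (\<integral>x. (\<Sum>k\<in>K. b k * (r x * (\<Prod>j\<in>K. B j x powr b j * (if j \<in> K - {k} then A j x else B j x)))) \<partial>?P)"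
    by (intro Bochner_Integration.integral_add nbm_integrable P.finite_measure_axioms L nbm_sum nbm_mult[OF nbm_const] nT b)
  also have "(\<integral>x. (\<Sum>k\<in>K. b k * (r x * (\<Prod>j\<in>K. B j x powr b j * (if j \<in> K - {k} then A j x else B j x)))) \<partial>?P)
      = (\<Sum>k\<in>K. \<integral>x. b k * (r x * (\<Prod>j\<in>K. B j x powr b j * (if j \<in> K - {k} then A j x else B j x))) \<partial>?P)"
    by (intro Bochner_Integration.integral_sum nbm_integrable P.finite_measure_axioms nbm_mult[OF nbm_const] nT b)
  also have "\<dots> = (\<Sum>k\<in>K. b k * T (K - {k}))"
    by (simp only: T_eq Bochner_Integration.integral_mult_right_zero)
  \<comment> \<open>Making level \<open>k\<close> joint as well can only increase \<open>T\<close>;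
    all error terms now are multiples of \<open>T K\<close>.\<close>
  also have "\<dots> \<le> (\<Sum>k\<in>K. b k * T K)"
    by (intro sum_mono mult_left_mono mono b) auto
  also have "(\<Sum>k\<in>K. b k * T K) = sum b K * T K" by (simp add: sum_distrib_right)
  finally have "T K \<le> integral\<^sup>L ?P L" by (simp add: algebra_simps)
  moreover have "T {} \<le> T K" by (rule mono) simp
  moreover have "T {} = (\<integral>x. r x * (\<Prod>k\<in>K. B k x powr a k) \<partial>?P)"
    unfolding T_eq
  proof (intro Bochner_Integration.integral_cong refl arg_cong2[where f = "(*)"] prod.cong)
    fix x k assume "x \<in> space ?P"
    then have "B k x powr b k * B k x = B k x powr a k"
      using powr_mult_base[OF nbm_nonneg[OF B], of x k "b k"] by (simp add: b_def mult.commute)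
    then show "B k x powr b k * (if k \<in> {} then A k x else B k x) = B k x powr a k" by simp
  qed
  ultimately show ?thesis by (simp add: L_def[abs_def] r_def A_def B_def)
qed

subsection \<open>Symmetrisation over permutations\<close>

text \<open>A bijection from \<open>A\<close> to \<open>B\<close> is glued to one between the
  complements, which have equal size too.\<close>

lemma permutation_extending:
  assumes "finite V" "A \<subseteq> V" "B \<subseteq> V" "card A = card B"
  obtains \<sigma> where "\<sigma> permutes V" "\<sigma> ` A = B"
proof -
  have fin: "finite A" "finite B" using assms finite_subset by auto
  obtain f where f: "bij_betw f A B" using finite_same_card_bij[OF fin assms(4)] by auto
  have "card (V - A) = card (V - B)" using assms fin by (simp add: card_Diff_subset)
  then obtain g where g: "bij_betw g (V - A) (V - B)"
    using finite_same_card_bij[of "V - A" "V - B"] assms(1) by auto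
  define \<sigma> where "\<sigma> x = (if x \<in> A then f x else if x \<in> V then g x else x)" for x
  have f': "bij_betw \<sigma> A B" using f by (rule bij_betw_cong[THEN iffD1, rotated]) (simp add: \<sigma>_def)
  have g': "bij_betw \<sigma> (V - A) (V - B)" using g by (rule bij_betw_cong[THEN iffD1, rotated]) (simp add: \<sigma>_def)
  have "bij_betw \<sigma> (A \<union> (V - A)) (B \<union> (V - B))" by (rule bij_betw_combine[OF f' g']) auto
  then have "bij_betw \<sigma> V V" using assms by (simp add: Un_absorb1)
  then have "\<sigma> permutes V" by (rule bij_imp_permutes) (use assms in \<open>auto simp: \<sigma>_def\<close>)
  then show ?thesis using that f' by (simp add: bij_betw_def)
qed

text \<open>Composing with a permutation that maps \<open>N\<close> to \<open>S\<close> shows that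
  every \<open>S\<close> of the right size is the image of \<open>N\<close> under the same number
  \<open>c\<close> of permutations. Counting all permutations gives
  \<open>fact (card V) = (card V choose card N) * c\<close>, which determines the exponent.\<close>

lemma prod_permutations_image:
  fixes h :: "'v set \<Rightarrow> real"
  assumes V: "finite V" and N: "N \<subseteq> V" and h: "\<And>S. S \<subseteq> V \<Longrightarrow> card S = card N \<Longrightarrow> 0 \<le> h S"
  shows "(\<Prod>\<pi>\<in>{\<pi>. \<pi> permutes V}. h (\<pi> ` N)) powr (1 / fact (card V))
    = (\<Prod>S\<in>{S. S \<subseteq> V \<and> card S = card N}. h S powr (1 / (card V choose card N)))"
proof -
  let ?P = "{\<pi>. \<pi> permutes V}" and ?A = "{S. S \<subseteq> V \<and> card S = card N}"
  define c where "c = card {\<pi>\<in>?P. \<pi> ` N = N}"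
  have finP: "finite ?P" using V by (rule finite_permutations)
  have finA: "finite ?A" using V by simp
  have img: "\<pi> ` N \<in> ?A" if "\<pi> \<in> ?P" for \<pi>
    using that N permutes_image[of \<pi> V] permutes_inj_on[of \<pi> V N] by (auto simp: card_image)
  have c: "card {\<pi>\<in>?P. \<pi> ` N = S} = c" if "S \<in> ?A" for S
  proof -
    have S: "S \<subseteq> V" "card N = card S" using that by auto
    obtain \<sigma> where \<sigma>: "\<sigma> permutes V" "\<sigma> ` N = S"
      by (rule permutation_extending[OF V N S])
    have "bij_betw (\<lambda>\<pi>. \<sigma> \<circ> \<pi>) {\<pi>\<in>?P. \<pi> ` N = N} {\<pi>\<in>?P. \<pi> ` N = S}"
    proof (rule bij_betwI[where g = "\<lambda>\<pi>. inv \<sigma> \<circ> \<pi>"])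
      have inj: "inj \<sigma>" using \<sigma>(1) by (rule permutes_inj)
      show "(\<lambda>\<pi>. \<sigma> \<circ> \<pi>) \<in> {\<pi>\<in>?P. \<pi> ` N = N} \<rightarrow> {\<pi>\<in>?P. \<pi> ` N = S}"
      proof
        fix \<pi> assume \<pi>: "\<pi> \<in> {\<pi>\<in>?P. \<pi> ` N = N}"
        have "(\<sigma> \<circ> \<pi>) ` N = \<sigma> ` \<pi> ` N" by (rule image_comp[symmetric])
        also have "\<dots> = S" using \<pi> \<sigma>(2)  by auto
        finally show "\<sigma> \<circ> \<pi> \<in> {\<pi>\<in>?P. \<pi> ` N = S}"
          using \<pi> permutes_compose[OF _ \<sigma>(1), of \<pi>] by simp
      qed
      show "(\<lambda>\<pi>. inv \<sigma> \<circ> \<pi>) \<in> {\<pi>\<in>?P. \<pi> ` N = S} \<rightarrow> {\<pi>\<in>?P. \<pi> ` N = N}"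
      proof
        fix \<pi> assume \<pi>: "\<pi> \<in> {\<pi>\<in>?P. \<pi> ` N = S}"
        have "(inv \<sigma> \<circ> \<pi>) ` N = inv \<sigma> ` \<pi> ` N" by (rule image_comp[symmetric])
        also have "\<dots> = N" using \<pi> \<sigma>(2) image_inv_f_f[OF inj, of N] by auto
        finally show "inv \<sigma> \<circ> \<pi> \<in> {\<pi>\<in>?P. \<pi> ` N = N}"
          using \<pi> permutes_compose[OF _ permutes_inv[OF \<sigma>(1)], of \<pi>] by simp
      qed
      show "inv \<sigma> \<circ> (\<sigma> \<circ> \<pi>) = \<pi>" for \<pi> using inj by (simp add: o_assoc)
      show "\<sigma> \<circ> (inv \<sigma> \<circ> \<pi>) = \<pi>" for \<pi>
        using permutes_surj[OF \<sigma>(1)] by (simp add: o_assoc surj_iff)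
    qed
    then show ?thesis by (simp add: c_def bij_betw_same_card)
  qed
  have "fact (card V) = card ?P" using V card_permutations[of V "card V"] by simp
  also have "\<dots> = (\<Sum>S\<in>?A. card {\<pi>\<in>?P. \<pi> ` N = S})"
    using sum.group[OF finP finA, of "\<lambda>\<pi>. \<pi> ` N" "\<lambda>_. 1::nat"] img by (auto simp: image_subset_iff)
  also have "\<dots> = (card V choose card N) * c" 
    by (simp only: sum.cong[OF refl c] sum_constant n_subsets[OF V] of_nat_id)
  finally have fact: "fact (card V) = (card V choose card N) * c" .
  then have "c > 0" by (metis fact_nonzero mult_0_right neq0_conv)
  have ratio: "real c * (1 / fact (card V)) = 1 / (card V choose card N)"
  proof -
    have "real (fact (card V)) = real (card V choose card N) * real c"
      unfolding fact by (rule of_nat_mult)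
    then show ?thesis using \<open>c > 0\<close> by simp
  qed
  have "(\<Prod>\<pi>\<in>?P. h (\<pi> ` N)) = (\<Prod>S\<in>?A. \<Prod>\<pi>\<in>{\<pi>\<in>?P. \<pi> ` N = S}. h (\<pi> ` N))"
    using img by (intro prod.group[symmetric] finP finA) auto
  also have "\<dots> = (\<Prod>S\<in>?A. h S ^ c)"
  proof (intro prod.cong refl)
    fix S assume "S \<in> ?A"
    have "(\<Prod>\<pi>\<in>{\<pi>\<in>?P. \<pi> ` N = S}. h (\<pi> ` N)) = (\<Prod>\<pi>\<in>{\<pi>\<in>?P. \<pi> ` N = S}. h S)"
      by (intro prod.cong refl) auto
    then show "(\<Prod>\<pi>\<in>{\<pi>\<in>?P. \<pi> ` N = S}. h (\<pi> ` N)) = h S ^ c"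
      by (simp only: prod_constant c[OF \<open>S \<in> ?A\<close>])
  qed
  finally have "(\<Prod>\<pi>\<in>?P. h (\<pi> ` N)) powr (1 / fact (card V)) = (\<Prod>S\<in>?A. (h S ^ c) powr (1 / fact (card V)))"
    by (simp add: prod_powr_distrib)
  also have "\<dots> = (\<Prod>S\<in>?A. h S powr (1 / (card V choose card N)))"
  proof (intro prod.cong refl)
    fix S assume "S \<in> ?A"
    \<comment> \<open>For \<open>h S = 0\<close> both sides are \<open>0\<close> only because
      \<open>c\<close> is positive.\<close>
    then have "h S ^ c = h S powr real c"
      using h[of S] \<open>c > 0\<close> by (cases "h S = 0") (auto simp: powr_realpow)
    then show "(h S ^ c) powr (1 / fact (card V)) = h S powr (1 / (card V choose card N))"
      by (simp only: powr_powr ratio)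
  qed
  finally show ?thesis .
qed

text \<open>All factors of the product measure are equal, so permuting the coordinates preserves
  it.\<close>

lemma integral_PiM_permute:
  assumes mu: "prob_space \<mu>" and \<pi>: "\<pi> permutes V" and f: "f \<in> borel_measurable (\<Pi>\<^sub>M v\<in>V. \<mu>)"
  shows "(\<integral>x. f (\<lambda>v\<in>V. x (\<pi> v)) \<partial>(\<Pi>\<^sub>M v\<in>V. \<mu>)) = (\<integral>x. (f x :: real) \<partial>(\<Pi>\<^sub>M v\<in>V. \<mu>))"
    and "(\<lambda>x. \<lambda>v\<in>V. x (\<pi> v)) \<in> (\<Pi>\<^sub>M v\<in>V. \<mu>) \<rightarrow>\<^sub>M (\<Pi>\<^sub>M v\<in>V. \<mu>)"
proof -
  have in_V: "\<pi> v \<in> V" if "v \<in> V" for v using permutes_in_image[OF \<pi>] that by simp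
  show m: "(\<lambda>x. \<lambda>v\<in>V. x (\<pi> v)) \<in> (\<Pi>\<^sub>M v\<in>V. \<mu>) \<rightarrow>\<^sub>M (\<Pi>\<^sub>M v\<in>V. \<mu>)"
    by (rule measurable_restrict) (simp add: in_V)
  have "distr (\<Pi>\<^sub>M v\<in>V. \<mu>) (\<Pi>\<^sub>M v\<in>V. \<mu>) (\<lambda>x. \<lambda>v\<in>V. x (\<pi> v)) = (\<Pi>\<^sub>M v\<in>V. \<mu>)"
    using distr_PiM_reindex[where M = "\<lambda>_. \<mu>" and f = \<pi> and K = V and I = V] mu in_V permutes_inj_on[OF \<pi>] by auto
  then show "(\<integral>x. f (\<lambda>v\<in>V. x (\<pi> v)) \<partial>(\<Pi>\<^sub>M v\<in>V. \<mu>)) = (\<integral>x. f x \<partial>(\<Pi>\<^sub>M v\<in>V. \<mu>))"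
    using integral_distr[OF m f] by simp
qed

text \<open>For one-element sets the joint and the split product coincide, so level 1 is moved into
  the vertex weight with whatever exponent it has. This is why the number of vertices of degree 1 is
  unrestricted.\<close>

lemma integral_split_le_joint_nonneg_level1:
  assumes mu: "prob_space \<mu>" and nu: "prob_space \<nu>" and V: "finite V" and F: "nbm \<mu> F"
    and W: "\<And>k. nbm (\<mu> \<Otimes>\<^sub>M \<nu>) (W k)" and K: "finite K" "0 \<notin> K"
    and a: "\<And>k. k \<in> K \<Longrightarrow> k \<noteq> 1 \<Longrightarrow> 1 \<le> a k" and a1: "0 \<le> a 1"
  shows "(\<integral>x. (\<Prod>v\<in>V. F (x v)) * (\<Prod>k\<in>K. split_prod \<nu> V k (W k) x powr a k) \<partial>(\<Pi>\<^sub>M v\<in>V. \<mu>))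
    \<le> (\<integral>x. (\<Prod>v\<in>V. F (x v)) * (\<Prod>k\<in>K. joint_prod \<nu> V k (W k) x powr a k) \<partial>(\<Pi>\<^sub>M v\<in>V. \<mu>))"
proof (cases "1 \<in> K")
  case False
  then show ?thesis using a by (intro integral_split_le_joint mu nu V F W K) force
next
  case True
  define F' where "F' x = F x * (\<integral>y. W 1 (x, y) \<partial>\<nu>) powr a 1" for x
  have F': "nbm \<mu> F'" unfolding F'_def by (intro nbm_mult F nbm_powr nbm_degree nu W a1)
  have s1: "split_prod \<nu> V 1 (W 1) x powr a 1 = (\<Prod>v\<in>V. (\<integral>y. W 1 (x v, y) \<partial>\<nu>) powr a 1)" for x
    by (simp add: split_prod_eq[OF V] prod_powr_distrib)
  have "joint_prod \<nu> V 1 (W 1) x = split_prod \<nu> V 1 (W 1) x" for x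
    unfolding joint_prod_def split_prod_def by (intro prod.cong refl) (auto simp: card_1_singleton_iff)
  then have j1: "joint_prod \<nu> V 1 (W 1) x powr a 1 = (\<Prod>v\<in>V. (\<integral>y. W 1 (x v, y) \<partial>\<nu>) powr a 1)" for x
    by (simp only: s1)
  have eq: "(\<Prod>v\<in>V. F (x v)) * (\<Prod>k\<in>K. q k x powr a k) = (\<Prod>v\<in>V. F' (x v)) * (\<Prod>k\<in>K - {1}. q k x powr a k)"
    if "q 1 x powr a 1 = (\<Prod>v\<in>V. (\<integral>y. W 1 (x v, y) \<partial>\<nu>) powr a 1)" for q x
    using that prod.remove[OF K(1) True, of "\<lambda>k. q k x powr a k"]
    by (simp add: F'_def prod.distrib mult_ac)
  show ?thesis
    unfolding eq[of "\<lambda>k. split_prod \<nu> V k (W k)", OF s1] eq[of "\<lambda>k. joint_prod \<nu> V k (W k)", OF j1]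
    using a K by (intro integral_split_le_joint mu nu V F' W) auto
qed

text \<open>Hoelder for the two functions \<open>f\<close> and \<open>1\<close> with weights
  \<open>t\<close> and \<open>1 - t\<close>; the case \<open>t = 1\<close> is separate because the
  weights there must be positive.\<close>

lemma integral_powr_le:
  assumes M: "prob_space M" and f: "nbm M f" and t: "0 < t" "t \<le> 1"
  shows "(\<integral>x. f x powr t \<partial>M) \<le> (\<integral>x. f x \<partial>M) powr t"
proof (cases "t = 1")
  case True
  have "(\<integral>x. f x powr 1 \<partial>M) = (\<integral>x. f x \<partial>M)"
    by (intro Bochner_Integration.integral_cong refl) (use nbm_nonneg[OF f] in auto)
  then show ?thesis using True nbm_integral_nonneg[OF f] by simp
next
  case False
  have nb: "nbm M (\<lambda>x. if i then f x else 1)" for i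
    using f nbm_const[of 1 M] by (cases i) auto
  have "(\<integral>x. (\<Prod>i\<in>UNIV. (if i then f x else 1) powr (if i then t else 1 - t)) \<partial>M)
      \<le> (\<Prod>i\<in>UNIV. (\<integral>x. (if i then f x else 1) \<partial>M) powr (if i then t else 1 - t))"
    using t False
    by (intro Hoelder_finite_family M nb) (auto simp: UNIV_bool)
  then show ?thesis by (simp add: UNIV_bool prob_space.prob_space[OF M])
qed

section \<open>Weighted common degrees and their average over permutations\<close>

text \<open>What a vertex of the second class with neighbourhood \<open>S\<close> and weight
  \<open>g\<close> contributes once its own variable has been integrated out.\<close>

definition common_degree :: "'y measure \<Rightarrow> ('y \<Rightarrow> real) \<Rightarrow> ('x \<times> 'y \<Rightarrow> real) \<Rightarrow> ('v \<Rightarrow> 'x) \<Rightarrow> 'v set \<Rightarrow> real" where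
  "common_degree \<nu> g W x S = (\<integral>y. g y * (\<Prod>v\<in>S. W (x v, y)) \<partial>\<nu>)"

lemma nbm_common_degree:
  assumes "prob_space \<nu>" "nbm \<nu> g" "nbm (\<mu> \<Otimes>\<^sub>M \<nu>) W" "S \<subseteq> V"
  shows "nbm (\<Pi>\<^sub>M v\<in>V. \<mu>) (\<lambda>x. common_degree \<nu> g W x S)"
  unfolding common_degree_def by (intro nbm_incidence_factor assms)

lemma common_degree_permute:
  assumes "\<pi> permutes V" "S \<subseteq> V"
  shows "common_degree \<nu> g W (\<lambda>v\<in>V. x (\<pi> v)) S = common_degree \<nu> g W x (\<pi> ` S)"
proof -
  have "(\<Prod>v\<in>S. W ((\<lambda>v\<in>V. x (\<pi> v)) v, y)) = (\<Prod>v\<in>\<pi> ` S. W (x v, y))" for y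
    using assms permutes_inj_on[OF assms(1), of S] by (subst prod.reindex) (auto intro!: prod.cong)
  then show ?thesis by (simp add: common_degree_def)
qed

text \<open>All coordinate permutations of the integrand have the same integral, so the right-hand
  side is the integral of their arithmetic mean. Their geometric mean is smaller and can be
  computed: every neighbourhood is spread evenly over all sets of its size, and every
  \<open>f v\<close> over all vertices.\<close>

lemma symmetrisation:
  fixes N :: "'w \<Rightarrow> 'v set" and \<mu> :: "'x measure"
  assumes mu: "prob_space \<mu>" and nu: "prob_space \<nu>" and V: "finite V"
    and N: "\<And>w. w \<in> U \<Longrightarrow> N w \<subseteq> V"
    and f: "\<And>v. v \<in> V \<Longrightarrow> nbm \<mu> (f v)" and g: "\<And>w. w \<in> U \<Longrightarrow> nbm \<nu> (g w)"
    and W: "nbm (\<mu> \<Otimes>\<^sub>M \<nu>) W"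
  shows "(\<integral>x. (\<Prod>u\<in>V. \<Prod>v\<in>V. f v (x u) powr (1 / card V)) *
      (\<Prod>w\<in>U. \<Prod>S\<in>{S. S \<subseteq> V \<and> card S = card (N w)}.
         common_degree \<nu> (g w) W x S powr (1 / (card V choose card (N w)))) \<partial>(\<Pi>\<^sub>M v\<in>V. \<mu>))
    \<le> (\<integral>x. (\<Prod>v\<in>V. f v (x v)) * (\<Prod>w\<in>U. common_degree \<nu> (g w) W x (N w)) \<partial>(\<Pi>\<^sub>M v\<in>V. \<mu>))"
    (is "(\<integral>x. ?L x \<partial>?P) \<le> (\<integral>x. ?R x \<partial>?P)")
proof -
  interpret P: prob_space ?P by (rule prob_space_PiM_const[OF mu])
  let ?\<Pi> = "{\<pi>. \<pi> permutes V}"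
  have cd: "nbm ?P (\<lambda>x. common_degree \<nu> (g w) W x S)" if "w \<in> U" "S \<subseteq> V" for w S
    by (intro nbm_common_degree nu g W that)
  have R: "nbm ?P ?R" by (intro nbm_mult nbm_prod nbm_component f cd N)
  have R\<pi>: "nbm ?P (\<lambda>x. ?R (\<lambda>v\<in>V. x (\<pi> v)))" if "\<pi> permutes V" for \<pi>
    by (rule nbm_comp[OF R integral_PiM_permute(2)[OF mu that nbm_measurable[OF R]]])
  have fin: "finite ?\<Pi>" using V by (rule finite_permutations)
  have card: "card ?\<Pi> = fact (card V)" using V by (simp add: card_permutations)
  have L_eq: "?L x = (\<Prod>\<pi>\<in>?\<Pi>. ?R (\<lambda>v\<in>V. x (\<pi> v))) powr (1 / fact (card V))" if x: "x \<in> space ?P" for x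
  proof -
    have xv: "x v \<in> space \<mu>" if "v \<in> V" for v using x that by (auto simp: space_PiM PiE_iff)
    \<comment> \<open>The vertex \<open>\<pi> v\<close> is written as the element of the image of
      \<open>{v}\<close>, so that \<open>prod_permutations_image\<close> covers the factors
      \<open>f v\<close> as well.\<close>
    have "(\<Prod>\<pi>\<in>?\<Pi>. ?R (\<lambda>v\<in>V. x (\<pi> v)))
        = (\<Prod>\<pi>\<in>?\<Pi>. (\<Prod>v\<in>V. f v (x (the_elem (\<pi> ` {v})))) * (\<Prod>w\<in>U. common_degree \<nu> (g w) W x (\<pi> ` N w)))"
      using N by (intro prod.cong refl) (auto simp: common_degree_permute intro!: arg_cong2[where f = "(*)"] prod.cong)
    also have "\<dots> = (\<Prod>v\<in>V. \<Prod>\<pi>\<in>?\<Pi>. f v (x (the_elem (\<pi> ` {v})))) *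
        (\<Prod>w\<in>U. \<Prod>\<pi>\<in>?\<Pi>. common_degree \<nu> (g w) W x (\<pi> ` N w))"
      by (simp only: prod.distrib prod.swap[of _ V ?\<Pi>] prod.swap[of _ U ?\<Pi>])
    finally have "(\<Prod>\<pi>\<in>?\<Pi>. ?R (\<lambda>v\<in>V. x (\<pi> v))) powr (1 / fact (card V))
       = (\<Prod>v\<in>V. (\<Prod>\<pi>\<in>?\<Pi>. f v (x (the_elem (\<pi> ` {v})))) powr (1 / fact (card V))) *
        (\<Prod>w\<in>U. (\<Prod>\<pi>\<in>?\<Pi>. common_degree \<nu> (g w) W x (\<pi> ` N w)) powr (1 / fact (card V)))"
      by (simp only: powr_mult prod_powr_distrib)
    also have "(\<Prod>w\<in>U. (\<Prod>\<pi>\<in>?\<Pi>. common_degree \<nu> (g w) W x (\<pi> ` N w)) powr (1 / fact (card V)))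
        = (\<Prod>w\<in>U. \<Prod>S\<in>{S. S \<subseteq> V \<and> card S = card (N w)}.
         common_degree \<nu> (g w) W x S powr (1 / (card V choose card (N w))))"
      by (intro prod.cong refl prod_permutations_image V N nbm_nonneg[OF cd x])
    also have "(\<Prod>v\<in>V. (\<Prod>\<pi>\<in>?\<Pi>. f v (x (the_elem (\<pi> ` {v})))) powr (1 / fact (card V)))
        = (\<Prod>v\<in>V. \<Prod>u\<in>V. f v (x u) powr (1 / card V))"
    proof (intro prod.cong refl)
      fix v assume v: "v \<in> V"
      have "(\<Prod>\<pi>\<in>?\<Pi>. f v (x (the_elem (\<pi> ` {v})))) powr (1 / fact (card V))
          = (\<Prod>S\<in>{S. S \<subseteq> V \<and> card S = card {v}}. f v (x (the_elem S)) powr (1 / (card V choose card {v})))"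
        using v by (intro prod_permutations_image V)
          (auto simp: card_1_singleton_iff intro!: nbm_nonneg[OF f] xv)
      also have "{S. S \<subseteq> V \<and> card S = card {v}} = (\<lambda>u. {u}) ` V"
        by (auto simp: card_1_singleton_iff)
      also have "(\<Prod>S\<in>(\<lambda>u. {u}) ` V. f v (x (the_elem S)) powr (1 / (card V choose card {v})))
          = (\<Prod>u\<in>V. f v (x u) powr (1 / card V))"
        by (subst prod.reindex) auto
      finally show "(\<Prod>\<pi>\<in>?\<Pi>. f v (x (the_elem (\<pi> ` {v})))) powr (1 / fact (card V))
          = (\<Prod>u\<in>V. f v (x u) powr (1 / card V))" .
    qed
    also have "\<dots> = (\<Prod>u\<in>V. \<Prod>v\<in>V. f v (x u) powr (1 / card V))" by (rule prod.swap)
    finally show ?thesis by (rule sym)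
  qed
  have "integral\<^sup>L ?P ?L \<le> (\<integral>x. (\<Sum>\<pi>\<in>?\<Pi>. ?R (\<lambda>v\<in>V. x (\<pi> v)) / card ?\<Pi>) \<partial>?P)"
  proof (rule nbm_integral_mono[OF P.finite_measure_axioms])
    show "nbm ?P ?L" by (intro nbm_mult nbm_prod nbm_component nbm_powr f cd) auto
    show "nbm ?P (\<lambda>x. \<Sum>\<pi>\<in>?\<Pi>. ?R (\<lambda>v\<in>V. x (\<pi> v)) / card ?\<Pi>)"
      unfolding divide_inverse by (intro nbm_sum nbm_mult R\<pi> nbm_const) auto
    fix x assume x: "x \<in> space ?P"
    show "?L x \<le> (\<Sum>\<pi>\<in>?\<Pi>. ?R (\<lambda>v\<in>V. x (\<pi> v)) / card ?\<Pi>)"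
      unfolding L_eq[OF x]
      using arith_geom_mean[OF fin, of "\<lambda>\<pi>. ?R (\<lambda>v\<in>V. x (\<pi> v))"] nbm_nonneg[OF R\<pi> x] permutes_id[of V]
      unfolding card by fastforce
  qed
  also have "\<dots> = (\<Sum>\<pi>\<in>?\<Pi>. (\<integral>x. ?R (\<lambda>v\<in>V. x (\<pi> v)) \<partial>?P) / card ?\<Pi>)"
    using nbm_integrable[OF P.finite_measure_axioms R\<pi>]
    by (subst Bochner_Integration.integral_sum) (auto intro!: integrable_divide)
  also have "\<dots> = (\<Sum>\<pi>\<in>?\<Pi>. integral\<^sup>L ?P ?R / card ?\<Pi>)"
    by (intro sum.cong refl arg_cong2[where f = "(/)"] integral_PiM_permute(1) mu nbm_measurable[OF R]) simp
  also have "\<dots> = integral\<^sup>L ?P ?R"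
    by (simp add: card)
  finally show ?thesis .
qed

section \<open>Merging vertices of equal degree\<close>

text \<open>One kernel that stands for all vertices in \<open>U\<close>. In a product over the
  \<open>k\<close> elements of a set the exponents of \<open>g w\<close> add up to
  \<open>1 / card U\<close>, the weight with which \<open>w\<close> enters Hoelder's
  inequality.\<close>

definition merged_weight :: "('w \<Rightarrow> 'y \<Rightarrow> real) \<Rightarrow> ('x \<times> 'y \<Rightarrow> real) \<Rightarrow> 'w set \<Rightarrow> nat \<Rightarrow> 'x \<times> 'y \<Rightarrow> real" where
  "merged_weight g W U k p = (\<Prod>w\<in>U. g w (snd p) powr (1 / (card U * k))) * W p"

lemma nbm_merged_weight:
  assumes "nbm (\<mu> \<Otimes>\<^sub>M \<nu>) W" "\<And>w. w \<in> U \<Longrightarrow> nbm \<nu> (g w)"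
  shows "nbm (\<mu> \<Otimes>\<^sub>M \<nu>) (merged_weight g W U k)"
  unfolding merged_weight_def by (intro nbm_mult nbm_prod nbm_powr nbm_comp[OF assms(2)] assms(1)) auto

text \<open>For each \<open>S\<close> the merged integrand is the geometric mean over
  \<open>w\<close> of the integrands of the common degrees, so Hoelder with equal weights bounds its
  integral. Raising to the power \<open>card U / (card V choose k)\<close> and exchanging the
  products gives the claim.\<close>

lemma joint_prod_merged_le:
  assumes nu: "prob_space \<nu>" and V: "finite V" and U: "finite U" "U \<noteq> {}" and k: "k \<ge> 1"
    and g: "\<And>w. w \<in> U \<Longrightarrow> nbm \<nu> (g w)" and W: "nbm (\<mu> \<Otimes>\<^sub>M \<nu>) W"
    and x: "x \<in> space (\<Pi>\<^sub>M v\<in>V. \<mu>)"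
  shows "joint_prod \<nu> V k (merged_weight g W U k) x powr (card U / (card V choose k))
    \<le> (\<Prod>w\<in>U. \<Prod>S\<in>{S. S \<subseteq> V \<and> card S = k}. common_degree \<nu> (g w) W x S powr (1 / (card V choose k)))"
proof -
  let ?A = "{S. S \<subseteq> V \<and> card S = k}"
  let ?J = "\<lambda>S. \<integral>y. (\<Prod>v\<in>S. merged_weight g W U k (x v, y)) \<partial>\<nu>"
  have xv: "x v \<in> space \<mu>" if "v \<in> V" for v using x that by (auto simp: space_PiM PiE_iff)
  have d: "card U > 0" using U by (simp add: card_gt_0_iff)
  have J: "0 \<le> ?J S" "?J S \<le> (\<Prod>w\<in>U. common_degree \<nu> (g w) W x S powr (1 / card U))" if S: "S \<in> ?A" for S
  proof -
    have sec: "nbm \<nu> (\<lambda>y. \<Prod>v\<in>S. W (x v, y))"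
      using S by (intro nbm_prod nbm_section[OF W] xv) auto
    show "0 \<le> ?J S"
      using S by (intro nbm_integral_nonneg nbm_prod nbm_section[OF nbm_merged_weight[OF W g]] xv) auto
    have "?J S = (\<integral>y. (\<Prod>w\<in>U. (g w y * (\<Prod>v\<in>S. W (x v, y))) powr (1 / card U)) \<partial>\<nu>)"
    proof (intro Bochner_Integration.integral_cong refl)
      fix y assume y: "y \<in> space \<nu>"
      have "((\<Prod>v\<in>S. W (x v, y)) powr (1 / card U)) ^ card U = (\<Prod>v\<in>S. W (x v, y))"
        using d nbm_nonneg[OF sec y] by (cases "(\<Prod>v\<in>S. W (x v, y)) = 0") (auto simp: powr_power)
      moreover have "(g w y powr (1 / (card U * k))) ^ k = g w y powr (1 / card U)" for w
        using k by (cases "g w y = 0") (auto simp: powr_power)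
      moreover have "(\<Prod>v\<in>S. \<Prod>w\<in>U. g w y powr (1 / (card U * k))) = (\<Prod>w\<in>U. (g w y powr (1 / (card U * k))) ^ k)"
        using S by (subst prod.swap) simp
      ultimately show "(\<Prod>v\<in>S. merged_weight g W U k (x v, y))
          = (\<Prod>w\<in>U. (g w y * (\<Prod>v\<in>S. W (x v, y))) powr (1 / card U))"
        by (simp add: merged_weight_def prod.distrib powr_mult)
    qed
    also have "\<dots> \<le> (\<Prod>w\<in>U. (\<integral>y. g w y * (\<Prod>v\<in>S. W (x v, y)) \<partial>\<nu>) powr (1 / card U))"
      using d by (intro Hoelder_finite_family nu U nbm_mult g sec) auto
    finally show "?J S \<le> (\<Prod>w\<in>U. common_degree \<nu> (g w) W x S powr (1 / card U))"
      by (simp add: common_degree_def)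
  qed
  have "joint_prod \<nu> V k (merged_weight g W U k) x powr (card U / (card V choose k))
      = (\<Prod>S\<in>?A. ?J S powr (card U / (card V choose k)))"
    by (simp add: joint_prod_def prod_powr_distrib)
  also have "\<dots> \<le> (\<Prod>S\<in>?A. (\<Prod>w\<in>U. common_degree \<nu> (g w) W x S powr (1 / card U)) powr (card U / (card V choose k)))"
    using J by (intro prod_mono) (auto intro!: powr_mono2)
  also have "\<dots> = (\<Prod>S\<in>?A. \<Prod>w\<in>U. common_degree \<nu> (g w) W x S powr (1 / (card V choose k)))"
    using d by (simp add: prod_powr_distrib powr_powr)
  also have "\<dots> = (\<Prod>w\<in>U. \<Prod>S\<in>?A. common_degree \<nu> (g w) W x S powr (1 / (card V choose k)))"
    by (rule prod.swap)
  finally show ?thesis .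
qed

section \<open>The inequality in terms of neighbourhoods\<close>

text \<open>Both sides are compared with the power \<open>n\<close> of the integral of
  \<open>Y\<close>. Symmetrisation, merging and the passage from joint to split products bound the
  right-hand side from below. On the left, Hoelder in \<open>y\<close> with weights
  \<open>k * d k / e\<close>, which sum to 1, bounds the inner integral by
  \<open>Y x powr (n / e)\<close>, and a second application in \<open>x\<close> finishes.\<close>

lemma sidorenko_neighbourhoods:
  fixes N :: "'w \<Rightarrow> 'v set" and U :: "'w set" and \<mu> :: "'x measure" and \<nu> :: "'y measure"
  defines "U' \<equiv> \<lambda>k. {w\<in>U. card (N w) = k}" and "e \<equiv> \<Sum>w\<in>U. card (N w)"
  assumes mu: "prob_space \<mu>" and nu: "prob_space \<nu>" and V: "finite V" "V \<noteq> {}" and U: "finite U"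
    and N: "\<And>w. w \<in> U \<Longrightarrow> N w \<subseteq> V" "\<And>w. w \<in> U \<Longrightarrow> N w \<noteq> {}"
    and f: "\<And>v. v \<in> V \<Longrightarrow> nbm \<mu> (f v)" and g: "\<And>w. w \<in> U \<Longrightarrow> nbm \<nu> (g w)"
    and W: "nbm (\<mu> \<Otimes>\<^sub>M \<nu>) W"
    and e: "card V \<le> e"
    and deg: "\<And>k. 2 \<le> k \<Longrightarrow> U' k \<noteq> {} \<Longrightarrow> card V choose k \<le> card (U' k)"
  shows "(\<integral>x. \<integral>y. (\<Prod>v\<in>V. f v x powr (1 / e)) * (\<Prod>w\<in>U. g w y powr (1 / e)) * W (x, y) \<partial>\<nu> \<partial>\<mu>) ^ e
    \<le> (\<integral>x. (\<Prod>v\<in>V. f v (x v)) * (\<Prod>w\<in>U. common_degree \<nu> (g w) W x (N w)) \<partial>(\<Pi>\<^sub>M v\<in>V. \<mu>))"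
proof -
  let ?P = "\<Pi>\<^sub>M v\<in>V. \<mu>"
  interpret mu: prob_space \<mu> by fact
  interpret P: prob_space ?P by (rule prob_space_PiM_const[OF mu])
  interpret PP: product_prob_space "\<lambda>_. \<mu>" V ..
  define n where "n = card V"
  have n: "n \<ge> 1" "e \<ge> n" using V e by (auto simp: n_def Suc_leI card_gt_0_iff)
  define K where "K = (\<lambda>w. card (N w)) ` U"
  define d where "d k = card (U' k)" for k
  define Wk where "Wk k = merged_weight g W (U' k) k" for k
  define D where "D k x = (\<integral>y. Wk k (x, y) \<partial>\<nu>)" for k x
  define a where "a k = d k / (n choose k)" for k
  define F where "F x = (\<Prod>v\<in>V. f v x powr (1 / n))" for x
  \<comment> \<open>Each vertex lies in \<open>(n - 1) choose (k - 1)\<close> of the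
    \<open>k\<close>-sets, and this number times \<open>a k\<close> is
    \<open>k * d k / n\<close>.\<close>
  define Y where "Y x = F x * (\<Prod>k\<in>K. D k x powr (k * d k / n))" for x
  have K: "finite K" using U by (simp add: K_def)
  have K_ge: "k \<ge> 1" "k \<le> n" "U' k \<noteq> {}" "d k \<ge> 1" if k: "k \<in> K" for k
  proof -
    obtain w where w: "w \<in> U" "k = card (N w)" using k by (auto simp: K_def)
    have "finite (N w)" using N(1)[OF w(1)] V finite_subset by auto
    then show "k \<ge> 1" using w N(2) by (simp add: Suc_leI card_gt_0_iff)
    show "k \<le> n" using w N(1) V by (simp add: n_def card_mono)
    show "U' k \<noteq> {}" using w by (auto simp: U'_def)
    then show "d k \<ge> 1" using U by (simp add: d_def U'_def Suc_leI card_gt_0_iff)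
  qed
  have U_split: "(\<Prod>w\<in>U. h w) = (\<Prod>k\<in>K. \<Prod>w\<in>U' k. h w)" for h :: "'w \<Rightarrow> real"
    unfolding U'_def by (rule prod.group[symmetric]) (use U K in \<open>auto simp: K_def\<close>)
  have e_eq: "e = (\<Sum>k\<in>K. k * d k)"
  proof -
    have "e = (\<Sum>k\<in>K. \<Sum>w\<in>{w\<in>U. card (N w) = k}. card (N w))"
      unfolding e_def by (rule sum.group[symmetric]) (use U K in \<open>auto simp: K_def\<close>)
    then show ?thesis by (simp add: d_def U'_def mult.commute)
  qed
  have g': "nbm \<nu> (g w)" if "w \<in> U' k" for w k using that g by (simp add: U'_def)
  have Wk: "nbm (\<mu> \<Otimes>\<^sub>M \<nu>) (Wk k)" for k unfolding Wk_def by (intro nbm_merged_weight W g')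
  have D: "nbm \<mu> (D k)" for k unfolding D_def by (intro nbm_degree nu Wk)
  have F: "nbm \<mu> F" unfolding F_def by (intro nbm_prod nbm_powr f) auto
  have Y: "nbm \<mu> Y" unfolding Y_def by (intro nbm_mult F nbm_prod nbm_powr D) auto
  have a: "1 \<le> a k" if "k \<in> K" "k \<noteq> 1" for k
  proof -
    have "n choose k \<le> d k" "n choose k > 0" using deg[of k] K_ge[OF that(1)] that by (auto simp: n_def d_def)
    then show ?thesis by (simp add: a_def)
  qed
  have "(\<integral>x. Y x \<partial>\<mu>) ^ n = (\<integral>x. (\<Prod>v\<in>V. Y (x v)) \<partial>?P)"
    using PP.product_integral_prod[OF V(1), of "\<lambda>_. Y"] nbm_integrable[OF mu.finite_measure_axioms Y]
    by (simp add: n_def)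
  also have "\<dots> = (\<integral>x. (\<Prod>v\<in>V. F (x v)) * (\<Prod>k\<in>K. split_prod \<nu> V k (Wk k) x powr a k) \<partial>?P)"
  proof (intro Bochner_Integration.integral_cong refl)
    fix x assume x: "x \<in> space ?P"
    have "(\<Prod>v\<in>V. D k (x v) powr (k * d k / n)) = split_prod \<nu> V k (Wk k) x powr a k" if k: "k \<in> K" for k
    proof -
      have "(D k (x v) ^ ((n - 1) choose (k - 1))) powr a k = D k (x v) powr (k * d k / n)" if "v \<in> V" for v
      proof -
        have "D k (x v) \<ge> 0" using x that by (intro nbm_nonneg[OF D]) (auto simp: space_PiM PiE_iff)
        moreover have m: "(n - 1) choose (k - 1) > 0" using K_ge[OF k] by simp
        ultimately have "D k (x v) ^ ((n - 1) choose (k - 1)) = D k (x v) powr ((n - 1) choose (k - 1))"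
          by (cases "D k (x v) = 0") (auto simp: powr_realpow)
        moreover have "real ((n - 1) choose (k - 1)) * a k = k * d k / n"
        proof -
          have "k * (n choose k) = n * ((n - 1) choose (k - 1))"
            using K_ge[OF k] by (intro times_binomial_minus1_eq) simp
          then have "real k * real (n choose k) = real n * real ((n - 1) choose (k - 1))"
            by (metis of_nat_mult)
          moreover have "n choose k > 0" using K_ge[OF k] by simp
          ultimately show ?thesis using n by (simp add: a_def field_simps)
        qed
        ultimately show ?thesis by (simp only: powr_powr)
      qed
      then show ?thesis
        using split_prod_eq[OF V(1) K_ge(1)[OF k], of \<nu> "Wk k" x]
        by (simp add: prod_powr_distrib D_def n_def)
    qed
    then have "(\<Prod>v\<in>V. \<Prod>k\<in>K. D k (x v) powr (k * d k / n)) = (\<Prod>k\<in>K. split_prod \<nu> V k (Wk k) x powr a k)"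
      by (subst prod.swap) (rule prod.cong[OF refl])
    then show "(\<Prod>v\<in>V. Y (x v)) = (\<Prod>v\<in>V. F (x v)) * (\<Prod>k\<in>K. split_prod \<nu> V k (Wk k) x powr a k)"
      by (simp only: Y_def prod.distrib)
  qed
  \<comment> \<open>The degree condition yields \<open>1 \<le> a k\<close> from level 2 on, hence
    the version that allows any nonnegative exponent at level 1.\<close>
  also have "\<dots> \<le> (\<integral>x. (\<Prod>v\<in>V. F (x v)) * (\<Prod>k\<in>K. joint_prod \<nu> V k (Wk k) x powr a k) \<partial>?P)"
    using a K_ge(1) by (intro integral_split_le_joint_nonneg_level1 mu nu V F Wk K) (force simp: a_def)+
  also have "\<dots> \<le> (\<integral>x. (\<Prod>v\<in>V. F (x v)) *
      (\<Prod>w\<in>U. \<Prod>S\<in>{S. S \<subseteq> V \<and> card S = card (N w)}.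
         common_degree \<nu> (g w) W x S powr (1 / (card V choose card (N w)))) \<partial>?P)"
  proof (rule nbm_integral_mono[OF P.finite_measure_axioms])
    show "nbm ?P (\<lambda>x. (\<Prod>v\<in>V. F (x v)) * (\<Prod>k\<in>K. joint_prod \<nu> V k (Wk k) x powr a k))"
      by (intro nbm_mult nbm_prod nbm_component F nbm_powr nbm_joint_prod nu Wk) (simp_all add: a_def)
    show "nbm ?P (\<lambda>x. (\<Prod>v\<in>V. F (x v)) *
      (\<Prod>w\<in>U. \<Prod>S\<in>{S. S \<subseteq> V \<and> card S = card (N w)}.
         common_degree \<nu> (g w) W x S powr (1 / (card V choose card (N w)))))"
      by (intro nbm_mult nbm_prod nbm_component F nbm_powr nbm_common_degree nu W g) auto
    fix x assume x: "x \<in> space ?P"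
    have "joint_prod \<nu> V k (Wk k) x powr a k
        \<le> (\<Prod>w\<in>U' k. \<Prod>S\<in>{S. S \<subseteq> V \<and> card S = card (N w)}.
         common_degree \<nu> (g w) W x S powr (1 / (card V choose card (N w))))" if k: "k \<in> K" for k
    proof -
      have "finite (U' k)" using U by (simp add: U'_def)
      then have "joint_prod \<nu> V k (Wk k) x powr a k
          \<le> (\<Prod>w\<in>U' k. \<Prod>S\<in>{S. S \<subseteq> V \<and> card S = k}. common_degree \<nu> (g w) W x S powr (1 / (card V choose k)))"
        unfolding Wk_def a_def d_def n_def
        using K_ge[OF k] by (intro joint_prod_merged_le[OF nu V(1) _ _ _ g' W x]) auto
      also have "\<dots> = (\<Prod>w\<in>U' k. \<Prod>S\<in>{S. S \<subseteq> V \<and> card S = card (N w)}.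
         common_degree \<nu> (g w) W x S powr (1 / (card V choose card (N w))))"
        by (intro prod.cong[OF refl]) (simp add: U'_def)
      finally show ?thesis .
    qed
    then show "(\<Prod>v\<in>V. F (x v)) * (\<Prod>k\<in>K. joint_prod \<nu> V k (Wk k) x powr a k) \<le> (\<Prod>v\<in>V. F (x v)) *
      (\<Prod>w\<in>U. \<Prod>S\<in>{S. S \<subseteq> V \<and> card S = card (N w)}.
         common_degree \<nu> (g w) W x S powr (1 / (card V choose card (N w))))"
      unfolding U_split
      by (intro mult_left_mono prod_mono nbm_nonneg[OF nbm_prod[OF nbm_component[OF F]] x]) auto
  qed
  also have "\<dots> \<le> (\<integral>x. (\<Prod>v\<in>V. f v (x v)) * (\<Prod>w\<in>U. common_degree \<nu> (g w) W x (N w)) \<partial>?P)"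
    unfolding F_def n_def by (rule symmetrisation[OF mu nu V(1) N(1) f g W])
  finally have lower: "(\<integral>x. Y x \<partial>\<mu>) ^ n \<le> (\<integral>x. (\<Prod>v\<in>V. f v (x v)) * (\<Prod>w\<in>U. common_degree \<nu> (g w) W x (N w)) \<partial>?P)" .
  let ?h = "\<lambda>x y. (\<Prod>v\<in>V. f v x powr (1 / e)) * (\<Prod>w\<in>U. g w y powr (1 / e)) * W (x, y)"
  have h: "nbm (\<mu> \<Otimes>\<^sub>M \<nu>) (\<lambda>p. ?h (fst p) (snd p))"
    using nbm_comp[OF f measurable_fst[of \<mu> \<nu>]] nbm_comp[OF g measurable_snd[of \<mu> \<nu>]] W
    by (intro nbm_mult nbm_prod nbm_powr) auto
  have inner: "(\<integral>y. ?h x y \<partial>\<nu>) \<le> Y x powr (n / e)" if x: "x \<in> space \<mu>" for x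
  proof -
    have "(\<Prod>w\<in>U. g w y powr (1 / e)) * W (x, y) = (\<Prod>k\<in>K. Wk k (x, y) powr (k * d k / e))"
      if y: "y \<in> space \<nu>" for y
    proof -
      have W0: "W (x, y) \<ge> 0" using x y by (intro nbm_nonneg[OF W]) (simp add: space_pair_measure)
      have "(\<Prod>k\<in>K. W (x, y) powr (k * d k / e)) = W (x, y)"
      proof (cases "W (x, y) = 0")
        case True
        \<comment> \<open>An empty product would be \<open>1\<close> and not
          \<open>W (x, y) = 0\<close>; positivity of \<open>e\<close> excludes this.\<close>
        have "K \<noteq> {}" using e_eq n by auto
        then show ?thesis using True K by auto
      next
        case False
        have "(\<Sum>k\<in>K. real (k * d k) / e) = 1"
          using e_eq n by (simp add: sum_divide_distrib[symmetric] flip: of_nat_sum of_nat_mult)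
        then show ?thesis using False W0 powr_sum[OF False, of "\<lambda>k. k * d k / e" K] by simp
      qed
      moreover have "(\<Prod>w\<in>U. g w y powr (1 / e))
          = (\<Prod>k\<in>K. (\<Prod>w\<in>U' k. g w y powr (1 / (card (U' k) * k))) powr (k * d k / e))"
        unfolding U_split
      proof (intro prod.cong refl)
        fix k assume k: "k \<in> K"
        \<comment> \<open>The exponent in \<open>merged_weight\<close> makes the total exponent of
          each \<open>g w\<close> equal to \<open>1 / e\<close>.\<close>
        have "1 / (real (card (U' k) * k)) * (k * d k / e) = 1 / e"
          using K_ge[OF k] by (simp add: d_def)
        then show "(\<Prod>w\<in>U' k. g w y powr (1 / e)) = (\<Prod>w\<in>U' k. g w y powr (1 / (card (U' k) * k))) powr (k * d k / e)"
          by (simp only: prod_powr_distrib powr_powr)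
      qed
      ultimately show ?thesis
        by (simp add: Wk_def merged_weight_def powr_mult prod.distrib)
    qed
    then have "(\<integral>y. (\<Prod>w\<in>U. g w y powr (1 / e)) * W (x, y) \<partial>\<nu>) = (\<integral>y. (\<Prod>k\<in>K. Wk k (x, y) powr (k * d k / e)) \<partial>\<nu>)"
      by (intro Bochner_Integration.integral_cong refl)
    also have "\<dots> \<le> (\<Prod>k\<in>K. D k x powr (k * d k / e))"
      unfolding D_def
    proof (intro Hoelder_finite_family nu K nbm_section[OF Wk] x)
      show "0 < real (k * d k) / e" if "k \<in> K" for k using K_ge[OF that] n by simp
      show "(\<Sum>k\<in>K. real (k * d k) / e) = 1"
        using e_eq n by (simp add: sum_divide_distrib[symmetric] flip: of_nat_sum of_nat_mult)
    qed
    finally have "(\<Prod>v\<in>V. f v x powr (1 / e)) * (\<integral>y. (\<Prod>w\<in>U. g w y powr (1 / e)) * W (x, y) \<partial>\<nu>)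
        \<le> (\<Prod>v\<in>V. f v x powr (1 / e)) * (\<Prod>k\<in>K. D k x powr (k * d k / e))"
      by (intro mult_left_mono prod_nonneg) auto
    also have "\<dots> = Y x powr (n / e)"
      using n by (simp add: Y_def F_def powr_mult prod_powr_distrib powr_powr)
    finally show ?thesis by (simp add: mult.assoc)
  qed
  have "(\<integral>x. \<integral>y. ?h x y \<partial>\<nu> \<partial>\<mu>) \<le> (\<integral>x. Y x powr (n / e) \<partial>\<mu>)"
    by (intro nbm_integral_mono mu.finite_measure_axioms nbm_integral nu h nbm_powr Y inner) auto
  \<comment> \<open>The exponent is at most 1 because \<open>n \<le> e\<close>.\<close>
  also have "\<dots> \<le> (\<integral>x. Y x \<partial>\<mu>) powr (n / e)"
    using n by (intro integral_powr_le mu Y) auto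
  finally have "(\<integral>x. \<integral>y. ?h x y \<partial>\<nu> \<partial>\<mu>) ^ e \<le> ((\<integral>x. Y x \<partial>\<mu>) powr (n / e)) ^ e"
    by (intro power_mono nbm_integral_nonneg nbm_integral nu h)
  also have "\<dots> = (\<integral>x. Y x \<partial>\<mu>) ^ n"
    using n nbm_integral_nonneg[OF Y]
    by (cases "(\<integral>x. Y x \<partial>\<mu>) = 0") (auto simp: powr_power powr_realpow power_0_left)
  finally show ?thesis using lower by linarith
qed

subsection \<open>Strong Sidorenko property\<close>

text \<open>For fixed \<open>x\<close> the edges are grouped by their endpoint in \<open>U\<close>.
  The integrand becomes a product of functions of the separate coordinates \<open>y w\<close>, and
  its integral is the product of the common degrees.\<close>

lemma hom_integral_eq:
  fixes \<mu> :: "'x measure" and \<nu> :: "'y measure" and E :: "('v \<times> 'w) set"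
  assumes mu: "prob_space \<mu>" and nu: "prob_space \<nu>" and V: "finite V" and U: "finite U"
    and E: "E \<subseteq> V \<times> U"
    and f: "\<And>v. v \<in> V \<Longrightarrow> nbm \<mu> (f v)" and g: "\<And>w. w \<in> U \<Longrightarrow> nbm \<nu> (g w)"
    and W: "nbm (\<mu> \<Otimes>\<^sub>M \<nu>) W"
  shows "(\<integral>(x, y). (\<Prod>v\<in>V. f v (x v)) * (\<Prod>w\<in>U. g w (y w)) * (\<Prod>(v, w)\<in>E. W (x v, y w))
      \<partial>((\<Pi>\<^sub>M v\<in>V. \<mu>) \<Otimes>\<^sub>M (\<Pi>\<^sub>M w\<in>U. \<nu>)))
    = (\<integral>x. (\<Prod>v\<in>V. f v (x v)) * (\<Prod>w\<in>U. common_degree \<nu> (g w) W x {v\<in>V. (v, w) \<in> E}) \<partial>(\<Pi>\<^sub>M v\<in>V. \<mu>))"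
proof -
  let ?P = "\<Pi>\<^sub>M v\<in>V. \<mu>" and ?Q = "\<Pi>\<^sub>M w\<in>U. \<nu>"
  interpret nu: prob_space \<nu> by fact
  interpret PP: product_prob_space "\<lambda>_. \<nu>" U ..
  let ?h = "\<lambda>x y. (\<Prod>v\<in>V. f v (x v)) * (\<Prod>w\<in>U. g w (y w)) * (\<Prod>(v, w)\<in>E. W (x v, y w))"
  have "nbm (?P \<Otimes>\<^sub>M ?Q) (\<lambda>p. f v (fst p v))" if "v \<in> V" for v
    using that by (intro nbm_comp[OF f]) measurable
  moreover have "nbm (?P \<Otimes>\<^sub>M ?Q) (\<lambda>p. g w (snd p w))" if "w \<in> U" for w
    using that by (intro nbm_comp[OF g]) measurable
  moreover have "nbm (?P \<Otimes>\<^sub>M ?Q) (\<lambda>p. case e of (v, w) \<Rightarrow> W (fst p v, snd p w))" if "e \<in> E" for e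
  proof -
    obtain v w where e: "e = (v, w)" "v \<in> V" "w \<in> U" using \<open>e \<in> E\<close> E by blast
    show ?thesis unfolding e(1) prod.case using e(2,3) by (intro nbm_comp[OF W]) measurable
  qed
  ultimately have h: "nbm (?P \<Otimes>\<^sub>M ?Q) (\<lambda>p. ?h (fst p) (snd p))"
    by (intro nbm_mult nbm_prod)
  have "(\<integral>(x, y). ?h x y \<partial>(?P \<Otimes>\<^sub>M ?Q)) = (\<integral>x. \<integral>y. ?h x y \<partial>?Q \<partial>?P)"
    using nbm_Fubini(1)[OF prob_space_PiM_const[OF mu] prob_space_PiM_const[OF nu] h]
    by (simp add: case_prod_beta')
  also have "\<dots> = (\<integral>x. (\<Prod>v\<in>V. f v (x v)) * (\<Prod>w\<in>U. common_degree \<nu> (g w) W x {v\<in>V. (v, w) \<in> E}) \<partial>?P)"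
  proof (intro Bochner_Integration.integral_cong refl)
    fix x assume "x \<in> space ?P"
    then have xv: "x v \<in> space \<mu>" if "v \<in> V" for v using that by (auto simp: space_PiM PiE_iff)
    have fin: "finite E" using E V U finite_subset by blast
    have edges: "(\<Prod>(v, w)\<in>E. W (x v, y w)) = (\<Prod>w\<in>U. \<Prod>v\<in>{v\<in>V. (v, w) \<in> E}. W (x v, y w))" for y
    proof -
      have "(\<Prod>w\<in>U. \<Prod>v\<in>{v\<in>V. (v, w) \<in> E}. W (x v, y w))
          = (\<Prod>(w, v)\<in>Sigma U (\<lambda>w. {v\<in>V. (v, w) \<in> E}). W (x v, y w))"
        using U V by (intro prod.Sigma) auto
      also have "\<dots> = (\<Prod>(v, w)\<in>E. W (x v, y w))"
        by (rule prod.reindex_bij_witness[where i = prod.swap and j = prod.swap]) (use E in auto)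
      finally show ?thesis by (rule sym)
    qed
    have "(\<integral>y. ?h x y \<partial>?Q) = (\<integral>y. (\<Prod>v\<in>V. f v (x v)) *
        (\<Prod>w\<in>U. g w (y w) * (\<Prod>v\<in>{v\<in>V. (v, w) \<in> E}. W (x v, y w))) \<partial>?Q)"
      by (simp add: edges prod.distrib mult.assoc)
    also have "\<dots> = (\<Prod>v\<in>V. f v (x v)) * (\<Prod>w\<in>U. common_degree \<nu> (g w) W x {v\<in>V. (v, w) \<in> E})"
      unfolding Bochner_Integration.integral_mult_right_zero common_degree_def
      by (intro arg_cong2[where f = "(*)"] refl PP.product_integral_prod U nbm_integrable
          nu.finite_measure_axioms nbm_mult g nbm_prod nbm_section[OF W] xv) auto
    finally show "(\<integral>y. ?h x y \<partial>?Q) = \<dots>" .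
  qed
  finally show ?thesis .
qed

theorem theorem3p6:
  fixes G :: "'v bigraph"
  assumes "is_bigraph G"
    and "\<forall>u\<in>verts1 G \<union> verts2 G. \<not> isolated G u"
    and "edges G \<noteq> {}"
    and "\<forall>k\<ge>2. num_degree2 G k = 0 \<or> num_degree2 G k \<ge> card (verts1 G) choose k"
  shows "strong_sidorenko TYPE('x) TYPE('y) G"
proof -
  define V where "V = verts1 G"
  define U where "U = verts2 G"
  define E where "E = edges G"
  define N where "N w = {v\<in>V. (v, w) \<in> E}" for w
  have V: "finite V" and U: "finite U" and disj: "V \<inter> U = {}" and E: "E \<subseteq> V \<times> U"
    using assms(1) by (auto simp: is_bigraph_def V_def U_def E_def)
  have finE: "finite E" using E V U finite_subset by blast
  have degree: "card {e\<in>E. snd e = w} = card (N w)" for w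
  proof -
    have "{e\<in>E. snd e = w} = (\<lambda>v. (v, w)) ` N w" using E by (auto simp: N_def)
    then show ?thesis by (simp add: card_image inj_on_def)
  qed
  have degree2: "degree G w = card (N w)" if "w \<in> U" for w
  proof -
    \<comment> \<open>\<open>degree\<close> counts edges at either endpoint; a vertex of
      \<open>U\<close> is never a first endpoint because \<open>V\<close> and \<open>U\<close> are
      disjoint.\<close>
    have "{e\<in>E. fst e = w \<or> snd e = w} = {e\<in>E. snd e = w}" using E disj that by auto
    then show ?thesis by (simp add: degree_def flip: E_def degree)
  qed
  have N: "N w \<subseteq> V" for w by (auto simp: N_def)
  have N_ne: "N w \<noteq> {}" if "w \<in> U" for w
  proof -
    have "degree G w \<noteq> 0" using assms(2) that by (auto simp: isolated_def U_def)
    then show ?thesis using degree2[OF that] by (intro notI) (simp only: card.empty)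
  qed
  have card_E: "(\<Sum>w\<in>U. card (N w)) = card E"
  proof -
    have "snd ` E \<subseteq> U" using E by auto
    then show ?thesis using sum.group[OF finE U, of snd "\<lambda>_. 1::nat"] by (simp add: degree)
  qed
  \<comment> \<open>Every vertex of \<open>V\<close> lies on an edge, which gives the bound
    \<open>card V \<le> card E\<close> that the second use of Hoelder relies on.\<close>
  have "V \<subseteq> fst ` E"
  proof
    fix v assume v: "v \<in> V"
    then have "card {e\<in>E. fst e = v \<or> snd e = v} \<noteq> 0"
      using assms(2) by (auto simp: isolated_def degree_def V_def E_def)
    then obtain e where "e \<in> E" "fst e = v \<or> snd e = v" by (metis (mono_tags, lifting) card.empty empty_Collect_eq)
    moreover have "snd e \<in> U" using \<open>e \<in> E\<close> E by auto
    ultimately show "v \<in> fst ` E" using disj v by auto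
  qed
  then have card_V: "card V \<le> card E" using finE by (meson card_image_le card_mono finite_imageI le_trans)
  have V_ne: "V \<noteq> {}" using assms(3) E by (auto simp: E_def)
  have deg: "card V choose k \<le> card {w\<in>U. card (N w) = k}" if "2 \<le> k" "{w\<in>U. card (N w) = k} \<noteq> {}" for k
  proof -
    have "{w\<in>U. degree G w = k} = {w\<in>U. card (N w) = k}" using degree2 by auto
    then have "num_degree2 G k = card {w\<in>U. card (N w) = k}" by (simp add: num_degree2_def flip: U_def)
    moreover from this have "num_degree2 G k \<noteq> 0" using that(2) U by simp
    ultimately show ?thesis using assms(4) that(1) unfolding V_def by metis
  qed
  show ?thesis
    unfolding strong_sidorenko_def
  proof (intro allI impI)
    fix \<mu> :: "'x measure" and \<nu> :: "'y measure" and W f g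
    assume "bigraphon \<mu> \<nu> W" and f: "\<forall>v\<in>verts1 G. nbm \<mu> (f v)" and g: "\<forall>w\<in>verts2 G. nbm \<nu> (g w)"
    then have mu: "prob_space \<mu>" and nu: "prob_space \<nu>" and W: "nbm (\<mu> \<Otimes>\<^sub>M \<nu>) W"
      by (auto simp: bigraphon_def)
    have f': "\<And>v. v \<in> V \<Longrightarrow> nbm \<mu> (f v)" and g': "\<And>w. w \<in> U \<Longrightarrow> nbm \<nu> (g w)"
      using f g by (auto simp: V_def U_def)
    let ?h = "\<lambda>x y. (\<Prod>v\<in>V. f v x powr (1 / card E)) * (\<Prod>w\<in>U. g w y powr (1 / card E)) * W (x, y)"
    have h: "nbm (\<mu> \<Otimes>\<^sub>M \<nu>) (\<lambda>p. ?h (fst p) (snd p))"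
      using nbm_comp[OF f' measurable_fst[of \<mu> \<nu>]] nbm_comp[OF g' measurable_snd[of \<mu> \<nu>]] W
      by (intro nbm_mult nbm_prod nbm_powr) auto
    have "(\<integral>(x, y). ?h x y \<partial>(\<mu> \<Otimes>\<^sub>M \<nu>)) ^ card E = (\<integral>x. \<integral>y. ?h x y \<partial>\<nu> \<partial>\<mu>) ^ card E"
      using nbm_Fubini(1)[OF mu nu h] by (simp add: case_prod_beta')
    also have "\<dots> \<le> (\<integral>x. (\<Prod>v\<in>V. f v (x v)) * (\<Prod>w\<in>U. common_degree \<nu> (g w) W x (N w)) \<partial>(\<Pi>\<^sub>M v\<in>V. \<mu>))"
      unfolding card_E[symmetric]
      by (rule sidorenko_neighbourhoods[OF mu nu V V_ne U N]) (use N_ne f' g' W card_V deg card_E in auto)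
    also have "\<dots> = (\<integral>(x, y). (\<Prod>v\<in>V. f v (x v)) * (\<Prod>w\<in>U. g w (y w)) * (\<Prod>(v, w)\<in>E. W (x v, y w))
      \<partial>((\<Pi>\<^sub>M v\<in>V. \<mu>) \<Otimes>\<^sub>M (\<Pi>\<^sub>M w\<in>U. \<nu>)))"
      unfolding N_def by (rule hom_integral_eq[symmetric]) (fact mu nu V U E f' g' W)+
    finally show "(\<integral>(x, y). (\<Prod>v\<in>verts1 G. f v (x v)) * (\<Prod>w\<in>verts2 G. g w (y w)) *
                  (\<Prod>(v, w)\<in>edges G. W (x v, y w))
           \<partial>((\<Pi>\<^sub>M v\<in>verts1 G. \<mu>) \<Otimes>\<^sub>M (\<Pi>\<^sub>M w\<in>verts2 G. \<nu>)))
        \<ge> (\<integral>(x, y). (\<Prod>v\<in>verts1 G. f v x powr (1 / card (edges G))) *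
                    (\<Prod>w\<in>verts2 G. g w y powr (1 / card (edges G))) * W (x, y)
             \<partial>(\<mu> \<Otimes>\<^sub>M \<nu>)) ^ card (edges G)"
      unfolding V_def U_def E_def .
  qed
qed

end
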